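(* Let $I=[a,b]$ be a compact interval and let $F\in\mathcal{PM}(I,I)$ have forts $c_1<\dots<c_v$, with $c_0:=a$ and $c_{v+1}:=b$. Suppose $H(F)=1$, that $K(F)=[c_k,c_{k+1}]$ for some $1\le k\le v-1$, that $F$ is strictly increasing on $[c_k,c_{k+1}]$, and that $F$ does not satisfy the characteristic endpoints condition. Suppose that the restriction $F|_{[c_k,c_{k+1}]}:[c_k,c_{k+1}]\to[c_k,c_{k+1}]$ is reversing-correspondence, and that at least one of the following three conditions holds: (1) $c_k=F(c_{k+2})<F(c_k)<F(c_{k+1})=F(c_{k-1})<c_{k+1}$; (2) $c_k<F(c_{k+2})<F(c_k)<F(c_{k+1})<F(c_{k-1})<c_{k+1}$; (3) $c_k<F(c_{k+2})=F(c_k)<F(c_{k+1})<F(c_{k-1})=c_{k+1}$. Suppose further that both (L) and (R) hold: (L) There are an integer $s\ge 0$ and points $c_{\ell_0}:=c_{k-1}>c_{\ell_1}>\dots>c_{\ell_s}>c_{\ell_{s+1}}:=c_0$ from $\{c_0,\dots,c_{v}\}$ such that: for $0\le j\le s$, $F(c_{\ell_j})=F(c_{k-1})$ if $j\equiv 0$ or $1\pmod 4$, and $F(c_{\ell_j})=F(c_{k+2})$ if $j\equiv 2$ or $3\pmod 4$; for $0\le j\le s$ with $j\equiv 0,1$ or $3\pmod 4$, $\max_{x\in[c_{\ell_{j+1}},c_{\ell_j}]}F(x)=F(c_{k-1})$; for $0\le j\le s$ with $j\equiv 1,2$ or $3\pmod 4$, $\min_{x\in[c_{\ell_{j+1}},c_{\ell_j}]}F(x)=F(c_{k+2})$.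 (R) There are an integer $t\ge 0$ and points $c_{r_0}:=c_{k+2}<c_{r_1}<\dots<c_{r_t}<c_{r_{t+1}}:=c_{v+1}$ from $\{c_1,\dots,c_{v+1}\}$ such that: for $0\le j\le t$, $F(c_{r_j})=F(c_{k+2})$ if $j\equiv 0$ or $1\pmod 4$, and $F(c_{r_j})=F(c_{k-1})$ if $j\equiv 2$ or $3\pmod 4$; for $0\le j\le t$ with $j\equiv 0,1$ or $3\pmod 4$, $\min_{x\in[c_{r_j},c_{r_{j+1}}]}F(x)=F(c_{k+2})$; for $0\le j\le t$ with $j\equiv 1,2$ or $3\pmod 4$, $\max_{x\in[c_{r_j},c_{r_{j+1}}]}F(x)=F(c_{k-1})$. Then there exists a continuous function $f:I\to I$ with $f\circ f=F$ on $I$ and $H(f)=2$ such that $f$ is strictly decreasing on $[c_k,c_{k+1}]$.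
   Context: Let $I=[a,b]$ be a compact interval. A continuous map $F:I\to I$ is a piecewise monotone (PM) function if it has only finitely many forts (non-monotone points), where a fort is a point of $(a,b)$ in no neighbourhood of which $F$ is strictly monotone. If the forts are $c_1<\dots<c_v$, put $c_0:=a$, $c_{v+1}:=b$; then $F$ is strictly monotone on each $[c_i,c_{i+1}]$, $0\le i\le v$, and these subintervals are called the laps of $F$. $\mathcal{PM}(I,I)$ is the set of all PM functions $I\to I$, and $N(F)$ is the number of forts of $F$ (so $N(F)=v$, and $N(F^0)=0$, where $F^0$ is the identity and $F^i$ is the $i$-th iterate). The sequence $N(F^0)\le N(F)\le N(F^2)\le\cdots$ is nondecreasing; the height $H(F)$ is the smallest integer $i\ge 0$ with $N(F^i)=N(F^{i+1})$, and $H(F)=\infty$ if there is none. When $H(F)=1$, there is a lap of $F$ containing the range $F(I)$; this lap is called the characteristic interval $K(F)$. (Conversely, existence of a lap covering the range characterizes $H(F)=1$ for maps having forts.) Characteristic endpoints condition for $F$ with $K(F)=[a',b']$: $F$ on $I$ cannot reach $a'$, respectively $b'$, unless $F(a')=a'$, respectively $F(b')=b'$; i.e. ($a'\in F(I)\Rightarrow F(a')=a'$) and ($b'\in F(I)\Rightarrow F(b')=b'$). Reversing-correspondence: let $[\alpha,\beta]\subset\mathbb{R}$ be a compact interval and $\phi:[\alpha,\beta]\to[\alpha,\beta]$ a strictly increasing continuous function, with fixed point set $\mathrm{Fix}\,\phi$. Then $\phi$ is called reversing-correspondence if (i) there exist a point $\xi\in\mathrm{Fix}\,\phi$ and a strictly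 decreasing map $\omega$ of $\mathrm{Fix}\,\phi$ onto itself with $\omega(\xi)=\xi$; (ii) $\alpha$ and $\beta$ either both belong to $\mathrm{Fix}\,\phi$ or both do not; (iii) for every pair of consecutive fixed points $\xi_1<\xi_2\le\xi$ of $\phi$, one has $(\phi(x)-x)(\phi(y)-y)<0$ for all $(x,y)\in(\xi_1,\xi_2)\times(\omega(\xi_2),\omega(\xi_1))$. *)

theory Defs
  imports "HOL-Analysis.Analysis"
begin

text \<open>A self-map of the interval \<open>I = [a, b]\<close> is a function \<open>real \<Rightarrow> real\<close> whose values outside
  \<open>{a..b}\<close> are irrelevant; every notion below depends only on the values on \<open>{a..b}\<close>
  (for maps sending \<open>{a..b}\<close> into itself).\<close>

definition strictly_monotone_on :: "real set \<Rightarrow> (real \<Rightarrow> real) \<Rightarrow> bool" where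
  "strictly_monotone_on S F \<longleftrightarrow> strict_mono_on S F \<or> strict_antimono_on S F"

definition forts :: "real \<Rightarrow> real \<Rightarrow> (real \<Rightarrow> real) \<Rightarrow> real set" where
  "forts a b F =
     {x \<in> {a<..<b}. \<nexists>U. open U \<and> x \<in> U \<and> strictly_monotone_on (U \<inter> {a..b}) F}"

definition pm_map :: "real \<Rightarrow> real \<Rightarrow> (real \<Rightarrow> real) \<Rightarrow> bool" where
  "pm_map a b F \<longleftrightarrow>
     continuous_on {a..b} F \<and> F ` {a..b} \<subseteq> {a..b} \<and> finite (forts a b F)"

text \<open>\<open>card\<close> is \<open>0\<close> on infinite sets, so \<open>fort_count\<close> is meaningful for maps satisfying
  \<open>pm_map\<close> only; these are closed under composition, hence so are all their iterates.\<close>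

definition fort_count :: "real \<Rightarrow> real \<Rightarrow> (real \<Rightarrow> real) \<Rightarrow> nat" where
  "fort_count a b F = card (forts a b F)"

definition height :: "real \<Rightarrow> real \<Rightarrow> (real \<Rightarrow> real) \<Rightarrow> enat" where
  "height a b F =
     (if \<exists>i. fort_count a b (F ^^ i) = fort_count a b (F ^^ Suc i)
      then enat (LEAST i. fort_count a b (F ^^ i) = fort_count a b (F ^^ Suc i))
      else \<infinity>)"

definition laps :: "real \<Rightarrow> real \<Rightarrow> (real \<Rightarrow> real) \<Rightarrow> real set set" where
  "laps a b F =
     {{p..q} | p q. p \<in> {a, b} \<union> forts a b F \<and> q \<in> {a, b} \<union> forts a b F \<and> p < q \<and>
        {p<..<q} \<inter> forts a b F = {}}"

text \<open>\<open>K\<close> is the characteristic interval of \<open>F\<close>. There is at most one such \<open>K\<close> when \<open>F\<close> is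
  continuous with finitely many forts and \<open>a < b\<close>, since the range is then a nondegenerate
  interval while distinct laps share at most one point.\<close>

definition characteristic_interval :: "real \<Rightarrow> real \<Rightarrow> (real \<Rightarrow> real) \<Rightarrow> real set \<Rightarrow> bool" where
  "characteristic_interval a b F K \<longleftrightarrow> K \<in> laps a b F \<and> F ` {a..b} \<subseteq> K"

text \<open>Here \<open>{a'..b'}\<close> is meant to be the characteristic interval of \<open>F\<close>.\<close>

definition characteristic_endpoints_condition ::
    "real \<Rightarrow> real \<Rightarrow> (real \<Rightarrow> real) \<Rightarrow> real \<Rightarrow> real \<Rightarrow> bool" where
  "characteristic_endpoints_condition a b F a' b' \<longleftrightarrow>
     (a' \<in> F ` {a..b} \<longrightarrow> F a' = a') \<and> (b' \<in> F ` {a..b} \<longrightarrow> F b' = b')"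

definition Fix_on :: "real set \<Rightarrow> (real \<Rightarrow> real) \<Rightarrow> real set" where
  "Fix_on S \<phi> = {x \<in> S. \<phi> x = x}"

definition consecutive_in :: "real set \<Rightarrow> real \<Rightarrow> real \<Rightarrow> bool" where
  "consecutive_in S x y \<longleftrightarrow> x \<in> S \<and> y \<in> S \<and> x < y \<and> {x<..<y} \<inter> S = {}"

definition reversing_correspondence :: "real \<Rightarrow> real \<Rightarrow> (real \<Rightarrow> real) \<Rightarrow> bool" where
  "reversing_correspondence \<alpha> \<beta> \<phi> \<longleftrightarrow>
     continuous_on {\<alpha>..\<beta>} \<phi> \<and> \<phi> ` {\<alpha>..\<beta>} \<subseteq> {\<alpha>..\<beta>} \<and> strict_mono_on {\<alpha>..\<beta>} \<phi> \<and>
     (let X = Fix_on {\<alpha>..\<beta>} \<phi> in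
       (\<alpha> \<in> X \<longleftrightarrow> \<beta> \<in> X) \<and>
       (\<exists>\<xi> \<in> X. \<exists>\<omega>. strict_antimono_on X \<omega> \<and> \<omega> ` X = X \<and> \<omega> \<xi> = \<xi> \<and>
         (\<forall>\<xi>\<^sub>1 \<xi>\<^sub>2. consecutive_in X \<xi>\<^sub>1 \<xi>\<^sub>2 \<and> \<xi>\<^sub>2 \<le> \<xi> \<longrightarrow>
           (\<forall>x \<in> {\<xi>\<^sub>1<..<\<xi>\<^sub>2}. \<forall>y \<in> {\<omega> \<xi>\<^sub>2<..<\<omega> \<xi>\<^sub>1}. (\<phi> x - x) * (\<phi> y - y) < 0))))"

text \<open>Maximum and minimum of \<open>F\<close> over a possibly infinite set (\<open>Max\<close> and \<open>Min\<close> are for finite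
  sets only).\<close>

definition is_max_on :: "real set \<Rightarrow> (real \<Rightarrow> real) \<Rightarrow> real \<Rightarrow> bool" where
  "is_max_on S F m \<longleftrightarrow> m \<in> F ` S \<and> (\<forall>x \<in> S. F x \<le> m)"

definition is_min_on :: "real set \<Rightarrow> (real \<Rightarrow> real) \<Rightarrow> real \<Rightarrow> bool" where
  "is_min_on S F m \<longleftrightarrow> m \<in> F ` S \<and> (\<forall>x \<in> S. m \<le> F x)"

end

(* Write p = c k, q = c (k + 1), m = F (c (k + 2)) and M = F (c (k - 1)).  The reversing
   correspondence lets one match each gap between fixed points of F on [p, q] with a gap on the
   other side of \<xi>, where F moves points in the opposite direction; conjugating F on matched gaps
   yields a decreasing h with h F = F h, and g = h on the left of \<xi>, g = h^{-1} F on the right,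
   is a decreasing root of F on [p, q].  The outermost gaps leave enough freedom to prescribe
   g p = M and g q = m.

   Then f0 = g^{-1} F extends g to [c (k - 1), c (k + 2)], and it increases from p to M on
   [c (k - 1), p] and from m to q on [q, c (k + 2)].  So f0 has three continuous right inverses:
   on [p, M], on [m, M] and on [m, q].  They agree at M (value p), respectively at m (value q),
   and conditions (L), (R) say exactly that F can be lifted through f0 continuously on the rest of
   [a, b] by switching between them at the given points.  Values f x > q occur just to the right
   of c (k + 2), which is therefore a fort of F but not of f, and this raises the height to 2. *)

theory Submission
  imports Defs
begin

text \<open>Neither p nor q is fixed, since p < F p and F q < q, so F maps [p, q] properly into
  itself and the outermost gaps are only forward invariant. Continuing F by translations outside
  [p, q] gives an increasing bijection of the line with the same fixed points; its gaps, two of them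
  unbounded, are invariant in both directions, and the same conjugacy argument serves all of them.
  An order-reversing h with h F = F h turns x < F x into F (h x) < h x, hence the demand that
  matched gaps move in opposite directions.

  The freedom is that of a fundamental domain: on the gap of p, h can be any decreasing bijection
  from [p, F p] onto [F M, M]. This covers g p = M at once. The condition g q = m concerns the
  right-hand side, where g is determined by h; but g (g q) = F q and g is injective, so it amounts
  to g m = F q, a second value of h in the same fundamental domain. This is the source of the
  relations between m, M, F p and F q in the alternatives (1) to (3).\<close>

section \<open>Conjugacies between gaps of the fixed point set\<close>

text \<open>Backward iterates are included because only the two-sided orbit of a point runs through
  a whole gap. For a surjection \<open>inv\<close> is a right inverse, which is enough for the
  recursion; for the increasing bijections below it is the inverse.\<close>

definition int_iter :: "('a \<Rightarrow> 'a) \<Rightarrow> int \<Rightarrow> 'a \<Rightarrow> 'a" where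
  "int_iter \<phi> n = (if 0 \<le> n then \<phi> ^^ nat n else inv \<phi> ^^ nat (- n))"

lemma int_iter_0 [simp]: "int_iter \<phi> 0 x = x"
  by (simp add: int_iter_def)

lemma int_iter_add_one:
  assumes "surj \<phi>"
  shows "int_iter \<phi> (n + 1) x = \<phi> (int_iter \<phi> n x)"
proof (cases "0 \<le> n")
  case True
  then show ?thesis by (simp add: int_iter_def nat_add_distrib)
next
  case False
  then have "nat (- n) = Suc (nat (- (n + 1)))" by simp
  then have "\<phi> (int_iter \<phi> n x) = (inv \<phi> ^^ nat (- (n + 1))) x"
    using False assms by (simp add: int_iter_def surj_f_inv_f)
  then show ?thesis using False by (cases "n = -1") (auto simp: int_iter_def)
qed

lemma strict_mono_int_iter:
  fixes \<phi> :: "'a::linorder \<Rightarrow> 'a"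
  assumes "strict_mono \<phi>" "surj \<phi>"
  shows "strict_mono (int_iter \<phi> n)"
proof (induction n rule: int_induct[where k=0])
  case base
  then show ?case by (simp add: strict_mono_def)
next
  case (step1 i)
  then show ?case
    using assms by (simp add: strict_mono_def int_iter_add_one)
next
  case (step2 i)
  have "int_iter \<phi> i x = \<phi> (int_iter \<phi> (i - 1) x)" for x
    using int_iter_add_one[OF assms(2), of "i - 1"] by simp
  then show ?case
    using step2 strict_mono_less[OF assms(1)] by (simp add: strict_mono_def)
qed

lemma int_iter_mem_iff:
  assumes "surj \<phi>" and "\<phi> -` G = G"
  shows "int_iter \<phi> n x \<in> G \<longleftrightarrow> x \<in> G"
proof (induction n rule: int_induct[where k=0])
  case (step2 i)
  have "int_iter \<phi> i x = \<phi> (int_iter \<phi> (i - 1) x)"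
    using int_iter_add_one[OF assms(1), of "i - 1"] by simp
  then show ?case using step2 assms(2) by auto
qed (use assms(2) in \<open>auto simp: int_iter_add_one[OF assms(1)]\<close>)

text \<open>An orbit cannot accumulate inside \<open>G\<close>. A supremum in \<open>G\<close> would
  have a smaller preimage; some orbit point lies beyond that preimage, so its image lies beyond the
  supremum. An infimum s in \<open>G\<close> satisfies s < \<phi> s; some orbit point lies below
  \<phi> s, so its predecessor lies below s. Surjectivity and monotonicity stand in for
  continuity.\<close>

lemma orbit_brackets:
  fixes \<phi> :: "real \<Rightarrow> real"
  assumes sm: "strict_mono \<phi>" and su: "surj \<phi>"
    and conv: "is_interval G"
    and inv: "\<phi> -` G = G"
    and up: "\<forall>x \<in> G. x < \<phi> x"
    and x0: "x0 \<in> G" and x: "x \<in> G"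
  obtains n where "int_iter \<phi> n x0 \<le> x" "x < int_iter \<phi> (n + 1) x0"
proof -
  let ?o = "\<lambda>n. int_iter \<phi> n x0"
  have inv': "\<phi> y \<in> G \<longleftrightarrow> y \<in> G" for y using inv by blast
  have oG: "?o n \<in> G" for n using int_iter_mem_iff[OF su inv] x0 by simp
  have ostep: "?o (n + 1) = \<phi> (?o n)" for n by (rule int_iter_add_one[OF su])
  have less: "?o n < ?o (n + 1)" for n using up oG ostep by simp
  have osm: "?o i \<le> ?o j" if "i \<le> j" for i j
    using that
  proof (induction j rule: int_ge_induct)
    case (step j)
    then show ?case using less[of j] by linarith
  qed simp
  have above: "\<exists>n. y < ?o n" if y: "y \<in> G" for y
  proof (rule ccontr)
    assume no: "\<not> ?thesis"
    define s where "s = (SUP n. ?o n)"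
    have bdd: "bdd_above (range ?o)" using no by (auto intro!: bdd_aboveI[of _ y] simp: not_less)
    have le: "?o n \<le> s" for n unfolding s_def by (rule cSUP_upper[OF _ bdd]) simp
    have "s \<le> y" unfolding s_def using no by (intro cSUP_least) (auto simp: not_less)
    then have sG: "s \<in> G" using mem_is_interval_1_I[OF conv x0 y] le[of 0] by simp
    obtain w where w: "s = \<phi> w" using su by (metis surjD)
    then have "w < s" using up inv' sG by metis
    then obtain n where "w < ?o n" unfolding s_def using less_cSUP_iff[OF _ bdd] by auto
    then have "s < ?o (n + 1)" using w ostep strict_monoD[OF sm] by simp
    then show False using le[of "n + 1"] by simp
  qed
  have below: "\<exists>n. ?o n < y" if y: "y \<in> G" for y
  proof (rule ccontr)
    assume no: "\<not> ?thesis"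
    define s where "s = (INF n. ?o n)"
    have bdd: "bdd_below (range ?o)" using no by (auto intro!: bdd_belowI[of _ y] simp: not_less)
    have le: "s \<le> ?o n" for n unfolding s_def by (rule cINF_lower[OF bdd]) simp
    have "y \<le> s" unfolding s_def using no by (intro cINF_greatest) (auto simp: not_less)
    then have sG: "s \<in> G" using mem_is_interval_1_I[OF conv y x0] le[of 0] by simp
    then have "s < \<phi> s" using up by blast
    then obtain n where "?o n < \<phi> s" unfolding s_def[symmetric]
      using cINF_less_iff[OF _ bdd] unfolding s_def by auto
    moreover have "?o n = \<phi> (?o (n - 1))" using ostep[of "n - 1"] by simp
    ultimately have "?o (n - 1) < s" using strict_mono_less[OF sm] by simp
    then show False using le[of "n - 1"] by simp
  qed
  obtain N where N: "x < ?o N" using above[OF x] by blast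
  obtain L where L: "?o L < x" using below[OF x] by blast
  \<comment> \<open>The search for the bracket is indexed by naturals counted from \<open>L\<close>,
    so that a least index exists; it is not 0 because the orbit point at \<open>L\<close> is below
    \<open>x\<close>.\<close>
  define k where "k = (LEAST k::nat. x < ?o (L + int k))"
  have "L \<le> N" using osm[of N L] N L by (meson less_asym' less_le_trans nle_le)
  then have "x < ?o (L + int (nat (N - L)))" using N by simp
  then have k: "x < ?o (L + int k)" unfolding k_def by (rule LeastI)
  have "k \<noteq> 0" using k L by (metis add.right_neutral int_ops(1) less_asym)
  then have "\<not> x < ?o (L + int (k - 1))" unfolding k_def by (intro not_less_Least) simp
  moreover have "L + int (k - 1) + 1 = L + int k" using \<open>k \<noteq> 0\<close> by simp
  ultimately show thesis using that[of "L + int (k - 1)"] k by simp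
qed

text \<open>The inverse of \<open>\<gamma>\<close> is a solution of Abel's equation for \<open>\<phi>\<close> on \<open>G\<close>.\<close>

lemma abel_parametrization:
  fixes \<phi> :: "real \<Rightarrow> real"
  assumes sm: "strict_mono \<phi>" and su: "surj \<phi>"
    and conv: "is_interval G"
    and inv: "\<phi> -` G = G"
    and up: "\<forall>x \<in> G. x < \<phi> x"
    and x0: "x0 \<in> G" and m: "x0 < m" "m < \<phi> x0"
  obtains \<gamma> :: "real \<Rightarrow> real" where "strict_mono \<gamma>" "range \<gamma> = G"
    "\<And>t. \<gamma> (t + 1) = \<phi> (\<gamma> t)" "\<gamma> 0 = x0" "\<gamma> (1/2) = m"
proof -
  \<comment> \<open>\<open>e\<close> maps [0, 1] onto the fundamental domain from \<open>x0\<close>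
    to \<open>\<phi> x0\<close>. It is linear on each half, with the bend at 1/2 placing the
    prescribed interior point \<open>m\<close>.\<close>
  define e :: "real \<Rightarrow> real" where
    "e t = (if t \<le> 1/2 then x0 + 2 * t * (m - x0) else m + (2 * t - 1) * (\<phi> x0 - m))" for t
  have e_mono: "e s < e t" if "s < t" for s t
  proof -
    consider "t \<le> 1/2" | "s \<le> 1/2" "1/2 < t" | "1/2 < s" using that by linarith
    then show ?thesis
    proof cases
      case 1
      then show ?thesis using that m by (simp add: e_def)
    next
      case 2
      have "2 * s * (m - x0) \<le> 1 * (m - x0)" using 2 m by (intro mult_right_mono) auto
      moreover have "0 < (2 * t - 1) * (\<phi> x0 - m)" using 2 m by (intro mult_pos_pos) auto
      ultimately show ?thesis using 2 by (simp add: e_def)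
    next
      case 3
      then show ?thesis using that m by (simp add: e_def)
    qed
  qed
  have e0: "e 0 = x0" and e1: "e 1 = \<phi> x0" and eh: "e (1/2) = m" by (auto simp: e_def)
  have e_surj: "\<exists>t. 0 \<le> t \<and> t < 1 \<and> e t = x" if x: "x0 \<le> x" "x < \<phi> x0" for x
  proof (cases "x \<le> m")
    case True
    let ?t = "(x - x0) / (m - x0) / 2"
    have "?t \<le> 1/2" "0 \<le> ?t" using True x m by (auto simp: field_simps)
    moreover have "2 * ?t * (m - x0) = x - x0" using m by (simp add: field_simps)
    then have "e ?t = x" using \<open>?t \<le> 1/2\<close> unfolding e_def by (simp only: if_True)
    ultimately show ?thesis by (intro exI[of _ ?t]) linarith
  next
    case False
    let ?t = "((x - m) / (\<phi> x0 - m) + 1) / 2"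
    have "?t < 1" "?t > 1/2" using False x m by (auto simp: field_simps)
    moreover have "(2 * ?t - 1) * (\<phi> x0 - m) = x - m" using m by (simp add: field_simps)
    then have "e ?t = x" using \<open>?t > 1/2\<close> unfolding e_def by (simp only: not_le[symmetric] if_False)
    ultimately show ?thesis by (intro exI[of _ ?t]) linarith
  qed
  \<comment> \<open>The integer part counts applications of \<open>\<phi>\<close> and the fractional
    part is the position in the fundamental domain. The relation between
    \<open>\<gamma> (t + 1)\<close> and \<open>\<gamma> t\<close> is thereby built in; monotonicity
    across integers and the range need the orbit estimates.\<close>
  define \<gamma> where "\<gamma> t = int_iter \<phi> \<lfloor>t\<rfloor> (e (frac t))" for t
  let ?o = "\<lambda>n. int_iter \<phi> n x0"
  have inv': "\<phi> y \<in> G \<longleftrightarrow> y \<in> G" for y using inv by blast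
  note ism = strict_mono_int_iter[OF sm su]
  have ostep: "int_iter \<phi> (n + 1) y = \<phi> (int_iter \<phi> n y)" for n y by (rule int_iter_add_one[OF su])
  have oG: "int_iter \<phi> n y \<in> G \<longleftrightarrow> y \<in> G" for n y using int_iter_mem_iff[OF su inv] by simp
  have ocomm: "int_iter \<phi> n (\<phi> y) = \<phi> (int_iter \<phi> n y)" for n y
  proof (induction n rule: int_induct[where k=0])
    case (step2 i)
    have "int_iter \<phi> i z = \<phi> (int_iter \<phi> (i - 1) z)" for z using ostep[of "i - 1"] by simp
    then show ?case using step2 strict_mono_eq[OF sm] by metis
  qed (simp_all add: ostep)
  have efrac: "e (frac t) < \<phi> x0" "x0 \<le> e (frac t)" for t
  proof -
    show "e (frac t) < \<phi> x0" using e_mono[of "frac t" 1] frac_lt_1[of t] e1 by simp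
    show "x0 \<le> e (frac t)" using e_mono[of 0 "frac t"] frac_ge_0[of t] e0
      by (metis less_eq_real_def)
  qed
  have lo: "?o \<lfloor>t\<rfloor> \<le> \<gamma> t" and hi: "\<gamma> t < ?o (\<lfloor>t\<rfloor> + 1)" for t
    using efrac[of t] strict_mono_less_eq[OF ism] strict_mono_less[OF ism]
    by (auto simp: \<gamma>_def ostep ocomm[symmetric])
  have less: "?o n < ?o (n + 1)" for n using up oG x0 ostep by simp
  have osm: "?o i \<le> ?o j" if "i \<le> j" for i j
    using that
  proof (induction j rule: int_ge_induct)
    case (step j)
    then show ?case using less[of j] by linarith
  qed simp
  have 1: "strict_mono \<gamma>"
  proof (rule strict_monoI)
    fix s t :: real assume st: "s < t"
    show "\<gamma> s < \<gamma> t"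
    proof (cases "\<lfloor>s\<rfloor> = \<lfloor>t\<rfloor>")
      case True
      then have "frac s < frac t" using st by (simp add: frac_def)
      then show ?thesis using True e_mono strict_monoD[OF ism] by (simp add: \<gamma>_def)
    next
      case False
      then have "\<lfloor>s\<rfloor> + 1 \<le> \<lfloor>t\<rfloor>" using st by (meson floor_mono int_one_le_iff_zero_less less_imp_le
          linorder_neqE_linordered_idom not_less zless_imp_add1_zle)
      then show ?thesis using hi[of s] lo[of t] osm by (meson less_le_trans)
    qed
  qed
  have 2: "range \<gamma> = G"
  proof (intro equalityI subsetI)
    fix x assume "x \<in> range \<gamma>"
    then obtain t where "x = \<gamma> t" by blast
    moreover have "e (frac t) \<in> G" using mem_is_interval_1_I[OF conv x0, of "\<phi> x0"] inv' x0 efrac[of t] by simp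
    ultimately show "x \<in> G" using oG by (simp add: \<gamma>_def)
  next
    fix x assume "x \<in> G"
    then obtain n where n: "?o n \<le> x" "x < ?o (n + 1)"
      using orbit_brackets[OF sm su conv inv up x0] by blast
    have "surj (int_iter \<phi> n)"
    proof (induction n rule: int_induct[where k=0])
      case base
      show ?case by (metis int_iter_0 surjI)
    next
      case (step1 i)
      have "int_iter \<phi> (i + 1) = \<phi> \<circ> int_iter \<phi> i" by (auto simp: ostep)
      then show ?case using step1 su comp_surj by metis
    next
      case (step2 i)
      have *: "int_iter \<phi> i z = \<phi> (int_iter \<phi> (i - 1) z)" for z using ostep[of "i - 1"] by simp
      show ?case
      proof (rule surjI)
        fix y
        have "int_iter \<phi> i (SOME w. int_iter \<phi> i w = \<phi> y) = \<phi> y"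
          using step2 by (metis (mono_tags, lifting) someI surjD)
        then show "int_iter \<phi> (i - 1) (SOME w. int_iter \<phi> i w = \<phi> y) = y"
          using * strict_mono_eq[OF sm] by metis
      qed
    qed
    then obtain w where w: "x = int_iter \<phi> n w" by (metis surjD)
    then have "x0 \<le> w" "w < \<phi> x0"
      using n strict_mono_less_eq[OF ism] strict_mono_less[OF ism]
      by (auto simp: ostep ocomm[symmetric])
    then obtain t where t: "0 \<le> t" "t < 1" "e t = w" using e_surj by blast
    then have "\<lfloor>of_int n + t\<rfloor> = n" "frac (of_int n + t) = t" by (auto simp: frac_def floor_eq_iff)
    then have "\<gamma> (of_int n + t) = x" using w t by (simp add: \<gamma>_def)
    then show "x \<in> range \<gamma>" by blast
  qed
  have 3: "\<gamma> (t + 1) = \<phi> (\<gamma> t)" for t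
    by (simp add: \<gamma>_def ostep frac_def)
  have 4: "\<gamma> 0 = x0" "\<gamma> (1/2) = m" using e0 eh by (auto simp: \<gamma>_def frac_def)
  show thesis using that[OF 1 2 3 4] .
qed

text \<open>In the parametrizations of both gaps, time advances by 1 under the dynamics. On
  \<open>H\<close>, where points move down, the reflected map \<open>\<psi>\<close> moves them up,
  so pairing equal times and reflecting back gives a decreasing map that commutes with
  \<open>\<phi>\<close>. The times 0 and 1/2 carry the two prescribed pairs.\<close>

lemma gap_conjugacy_interior:
  fixes \<phi> :: "real \<Rightarrow> real"
  assumes sm: "strict_mono \<phi>" and su: "surj \<phi>"
    and convG: "is_interval G"
    and convH: "is_interval H"
    and invG: "\<phi> -` G = G" and invH: "\<phi> -` H = H"
    and up: "\<forall>x \<in> G. x < \<phi> x" and down: "\<forall>x \<in> H. \<phi> x < x"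
    and x0: "x0 \<in> G" "x0 < m" "m < \<phi> x0" and y0: "y0 \<in> H" "\<phi> y0 < n" "n < y0"
  obtains h where "strict_antimono_on G h" "h ` G = H" "\<And>x. x \<in> G \<Longrightarrow> h (\<phi> x) = \<phi> (h x)"
    "h x0 = y0" "h m = n"
proof -
  obtain \<gamma> :: "real \<Rightarrow> real" where \<gamma>: "strict_mono \<gamma>" "range \<gamma> = G" "\<And>t. \<gamma> (t + 1) = \<phi> (\<gamma> t)"
    "\<gamma> 0 = x0" "\<gamma> (1/2) = m"
    using abel_parametrization[OF sm su convG invG up x0] by blast
  define \<psi> where "\<psi> x = - \<phi> (- x)" for x
  have "strict_mono \<psi>" using sm by (simp add: \<psi>_def strict_mono_def)
  moreover have "surj \<psi>" unfolding \<psi>_def using su by (intro surjI[of _ "\<lambda>x. - inv \<phi> (- x)"]) (simp add: surj_f_inv_f)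
  moreover have mem: "x \<in> uminus ` H \<longleftrightarrow> - x \<in> H" for x :: real by force
  moreover have "is_interval (uminus ` H)"
    using convH by simp
  moreover have "\<psi> -` uminus ` H = uminus ` H"
    using invH by (auto simp: mem \<psi>_def)
  moreover have "\<forall>x \<in> uminus ` H. x < \<psi> x"
    using down by (auto simp: \<psi>_def)
  moreover have "- y0 \<in> uminus ` H" "- y0 < - n" "- n < \<psi> (- y0)" using y0 by (auto simp: \<psi>_def)
  ultimately obtain \<delta> :: "real \<Rightarrow> real" where \<delta>: "strict_mono \<delta>" "range \<delta> = uminus ` H" "\<And>t. \<delta> (t + 1) = \<psi> (\<delta> t)"
    "\<delta> 0 = - y0" "\<delta> (1/2) = - n"
    using abel_parametrization[of \<psi> "uminus ` H" "- y0" "- n"] by blast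
  have inj: "inj \<gamma>" using \<gamma>(1) by (rule strict_mono_imp_inj_on)
  define h where "h x = - \<delta> (inv \<gamma> x)" for x
  have h: "h (\<gamma> t) = - \<delta> t" for t using inj by (simp add: h_def)
  show thesis
  proof (rule that)
    show "strict_antimono_on G h"
      unfolding \<gamma>(2)[symmetric]
      by (intro monotone_onI) (auto simp: h strict_mono_less[OF \<gamma>(1)] strict_mono_less[OF \<delta>(1)])
    have "h ` G = uminus ` range \<delta>" unfolding \<gamma>(2)[symmetric] by (simp add: image_image h)
    then show "h ` G = H" by (simp add: \<delta>(2) image_image)
    show "h (\<phi> x) = \<phi> (h x)" if x: "x \<in> G" for x
    proof -
      obtain t where "x = \<gamma> t" using \<gamma>(2) x by blast
      then show ?thesis by (simp add: h \<gamma>(3)[symmetric] \<delta>(3)) (simp add: \<psi>_def)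
    qed
    show "h x0 = y0" "h m = n" using h[of 0] h[of "1/2"] \<gamma>(4,5) \<delta>(4,5) by auto
  qed
qed

text \<open>If \<open>m\<close> is an end of the fundamental domain, its image is already forced by
  \<open>h x0 = y0\<close> and commutation, so any interior pair may be prescribed in its
  place.\<close>

lemma gap_conjugacy:
  fixes \<phi> :: "real \<Rightarrow> real"
  assumes sm: "strict_mono \<phi>" and su: "surj \<phi>"
    and convG: "is_interval G"
    and convH: "is_interval H"
    and invG: "\<phi> -` G = G" and invH: "\<phi> -` H = H"
    and up: "\<forall>x \<in> G. x < \<phi> x" and down: "\<forall>x \<in> H. \<phi> x < x"
    and x0: "x0 \<in> G" and y0: "y0 \<in> H"
    and mn: "m = x0 \<and> n = y0 \<or> m = \<phi> x0 \<and> n = \<phi> y0 \<or>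
      x0 < m \<and> m < \<phi> x0 \<and> \<phi> y0 < n \<and> n < y0"
  obtains h where "strict_antimono_on G h" "h ` G = H" "\<And>x. x \<in> G \<Longrightarrow> h (\<phi> x) = \<phi> (h x)"
    "h x0 = y0" "h m = n"
proof -
  obtain m' n' where *: "x0 < m'" "m' < \<phi> x0" "\<phi> y0 < n'" "n' < y0"
    and mn': "m = x0 \<and> n = y0 \<or> m = \<phi> x0 \<and> n = \<phi> y0 \<or> m = m' \<and> n = n'"
    using mn dense[OF bspec[OF up x0]] dense[OF bspec[OF down y0]] by metis
  obtain h where h: "strict_antimono_on G h" "h ` G = H" "\<And>x. x \<in> G \<Longrightarrow> h (\<phi> x) = \<phi> (h x)"
    "h x0 = y0" "h m' = n'"
    using gap_conjugacy_interior[OF sm su convG convH invG invH up down x0 *(1,2) y0 *(3,4)] by blast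
  then have "h m = n" using mn' x0 by auto
  then show thesis using that h by blast
qed

lemma strict_antimono_on_eq:
  fixes f :: "'a::linorder \<Rightarrow> 'b::linorder"
  assumes "strict_antimono_on A f" "x \<in> A" "y \<in> A"
  shows "f x < f y \<longleftrightarrow> y < x" "f x = f y \<longleftrightarrow> x = y"
  using assms by (metis (full_types) linorder_less_linear monotone_onD order_less_asym)+

lemma inj_on_strict_antimono_on:
  fixes f :: "'a::linorder \<Rightarrow> 'b::linorder"
  shows "strict_antimono_on A f \<Longrightarrow> inj_on f A"
  by (rule inj_onI) (simp add: strict_antimono_on_eq)

text \<open>When points of \<open>G\<close> move down, those of \<open>H\<close> move up; a
  conjugacy is then built from \<open>H\<close> to \<open>G\<close>, and its inverse is again
  decreasing and commutes with \<open>\<phi>\<close>.\<close>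

lemma gap_conjugacy_unoriented:
  fixes \<phi> :: "real \<Rightarrow> real"
  assumes sm: "strict_mono \<phi>" and su: "surj \<phi>"
    and convG: "is_interval G"
    and convH: "is_interval H"
    and invG: "\<phi> -` G = G" and invH: "\<phi> -` H = H"
    and opp: "\<forall>x \<in> G. \<forall>y \<in> H. (\<phi> x - x) * (\<phi> y - y) < 0"
    and ne: "x0 \<in> G" "y0 \<in> H"
  obtains h where "strict_antimono_on G h" "h ` G = H" "\<And>x. x \<in> G \<Longrightarrow> h (\<phi> x) = \<phi> (h x)"
proof -
  have oppD: "x < \<phi> x \<and> \<phi> y < y \<or> \<phi> x < x \<and> y < \<phi> y" if "x \<in> G" "y \<in> H" for x y
    using opp that by (auto simp: mult_less_0_iff)
  show ?thesis
  proof (cases "x0 < \<phi> x0")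
    case True
    then have down: "\<forall>y \<in> H. \<phi> y < y"
      using oppD[OF ne(1)] True by force
    have up: "\<forall>x \<in> G. x < \<phi> x"
      using oppD[OF _ ne(2)] down ne(2) by force
    show ?thesis
      by (rule gap_conjugacy[OF sm su convG convH invG invH up down ne, where m=x0 and n=y0]) (use that in auto)
  next
    case False
    then have up: "\<forall>y \<in> H. y < \<phi> y"
      using oppD[OF ne(1)] False by force
    have down: "\<forall>x \<in> G. \<phi> x < x"
      using oppD[OF _ ne(2)] up ne(2) by force
    obtain k where k: "strict_antimono_on H k" "k ` H = G" "\<And>x. x \<in> H \<Longrightarrow> k (\<phi> x) = \<phi> (k x)"
      by (rule gap_conjugacy[OF sm su convH convG invH invG up down ne(2,1), where m=y0 and n=x0]) auto
    note inj = inj_on_strict_antimono_on[OF k(1)]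
    define h where "h = the_inv_into H k"
    have invH': "\<phi> y \<in> H \<longleftrightarrow> y \<in> H" for y using invH by blast
    have h: "h (k y) = y" if "y \<in> H" for y using inj that by (simp add: h_def the_inv_into_f_f)
    show ?thesis
    proof (rule that)
      show "strict_antimono_on G h"
        unfolding k(2)[symmetric] by (intro monotone_onI) (auto simp: h strict_antimono_on_eq[OF k(1)])
      show "h ` G = H" unfolding k(2)[symmetric] by (simp add: h image_image cong: image_cong_simp)
      show "h (\<phi> x) = \<phi> (h x)" if "x \<in> G" for x
        using that unfolding k(2)[symmetric] by (auto simp: h k(3)[symmetric] invH')
    qed
  qed
qed

section \<open>Decreasing square roots\<close>

text \<open>\<open>R x y\<close> says that \<open>y\<close> lies in the gap of the fixed point set that \<open>\<omega>\<close> matches with the gap of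
  \<open>x\<close>. All of this is about the order only, so that unbounded gaps need no special
  treatment and no continuity is involved.\<close>

lemma decreasing_root:
  fixes \<phi> \<omega> :: "real \<Rightarrow> real" and \<xi> p M m n :: real and R :: "real \<Rightarrow> real \<Rightarrow> bool"
  defines "R \<equiv> \<lambda>x y. x < \<xi> \<and> \<xi> < y \<and> \<phi> x \<noteq> x \<and> \<phi> y \<noteq> y \<and>
    (\<forall>z \<le> \<xi>. \<phi> z = z \<longrightarrow> (z < x \<longleftrightarrow> y < \<omega> z))"
  assumes sm: "strict_mono \<phi>" and su: "surj \<phi>" and \<xi>: "\<phi> \<xi> = \<xi>" "\<omega> \<xi> = \<xi>"
    and \<omega>: "strict_antimono_on {z. \<phi> z = z \<and> z \<le> \<xi>} \<omega>"
      "\<omega> ` {z. \<phi> z = z \<and> z \<le> \<xi>} = {z. \<phi> z = z \<and> \<xi> \<le> z}"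
    and R1: "\<And>x. x < \<xi> \<Longrightarrow> \<phi> x \<noteq> x \<Longrightarrow> \<exists>y. R x y"
    and R2: "\<And>y. \<xi> < y \<Longrightarrow> \<phi> y \<noteq> y \<Longrightarrow> \<exists>x. R x y"
    and opp: "\<And>x y. R x y \<Longrightarrow> (\<phi> x - x) * (\<phi> y - y) < 0"
    and base: "R p M" "p < \<phi> p"
    and mn: "m = p \<and> n = M \<or> m = \<phi> p \<and> n = \<phi> M \<or>
      p < m \<and> m < \<phi> p \<and> \<phi> M < n \<and> n < M"
  obtains g where "strict_antimono_on UNIV g" "surj g" "\<And>x. g (g x) = \<phi> x" "g p = M" "g m = n"
proof -
  define H where "H x = {y. R x y}" for x
  define G where "G x = {x'. \<forall>y \<in> H x. R x' y}" for x
  have mono[simp]: "\<phi> x < \<phi> y \<longleftrightarrow> x < y" "\<phi> x = \<phi> y \<longleftrightarrow> x = y" for x y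
    using strict_mono_less[OF sm] strict_mono_eq[OF sm] by auto
  have fixless: "\<phi> x < z \<longleftrightarrow> x < z" "z < \<phi> x \<longleftrightarrow> z < x" if "\<phi> z = z" for x z
    using mono(1)[of x z] mono(1)[of z x] that by auto
  have \<omega>fix: "\<phi> (\<omega> z) = \<omega> z" "\<xi> \<le> \<omega> z" if "\<phi> z = z" "z \<le> \<xi>" for z using \<omega>(2) that by auto
  have Rinv1: "R (\<phi> x) y \<longleftrightarrow> R x y" and Rinv2: "R x (\<phi> y) \<longleftrightarrow> R x y" for x y
  proof -
    have "(\<forall>z \<le> \<xi>. \<phi> z = z \<longrightarrow> (z < \<phi> x \<longleftrightarrow> y < \<omega> z)) \<longleftrightarrow>
        (\<forall>z \<le> \<xi>. \<phi> z = z \<longrightarrow> (z < x \<longleftrightarrow> y < \<omega> z))"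
      using fixless(2) by metis
    then show "R (\<phi> x) y \<longleftrightarrow> R x y" unfolding R_def by (simp only: fixless[OF \<xi>(1)] mono(2))
    have "(\<forall>z \<le> \<xi>. \<phi> z = z \<longrightarrow> (z < x \<longleftrightarrow> \<phi> y < \<omega> z)) \<longleftrightarrow>
        (\<forall>z \<le> \<xi>. \<phi> z = z \<longrightarrow> (z < x \<longleftrightarrow> y < \<omega> z))"
      using fixless(1) \<omega>fix(1) by metis
    then show "R x (\<phi> y) \<longleftrightarrow> R x y" unfolding R_def by (simp only: fixless[OF \<xi>(1)] mono(2))
  qed
  have Rconv1: "R x' y" if "R x y" "R z y" "x \<le> x'" "x' \<le> z" for x x' y z
    using that unfolding R_def by (smt (verit))
  \<comment> \<open>\<open>R\<close> tests only fixed points to the left of \<open>\<xi>\<close>. A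
    fixed \<open>y'\<close> on the right is excluded because \<open>\<omega>\<close> is onto there:
    it would be some \<open>\<omega> w\<close> separating \<open>y\<close> from \<open>z\<close>,
    although \<open>R\<close> places both on the same side of it.\<close>
  have Rconv2: "R x y'" if "R x y" "R x z" "y \<le> y'" "y' \<le> z" for x y y' z
  proof -
    have "\<phi> y' \<noteq> y'"
    proof
      assume "\<phi> y' = y'"
      moreover have "\<xi> \<le> y'" using that unfolding R_def by simp
      ultimately obtain w where "\<phi> w = w" "w \<le> \<xi>" "y' = \<omega> w" using \<omega>(2) by blast
      then show False using that \<open>\<phi> y' = y'\<close> unfolding R_def by (smt (verit))
    qed
    then show ?thesis using that unfolding R_def by (smt (verit))
  qed
  have Rtrans: "R x' y'" if "R x y" "R x' y" "R x y'" for x x' y y'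
    using that unfolding R_def by blast
  have mem: "x \<in> G x" if "x < \<xi>" "\<phi> x \<noteq> x" for x
    using R1[OF that] by (auto simp: G_def H_def)
  have Geq: "H x' = H x" "G x' = G x" if "R x y" "R x' y" for x x' y
  proof -
    show *: "H x' = H x" using that Rtrans unfolding H_def by blast
    show "G x' = G x" unfolding G_def * ..
  qed
  define good where "good x h \<longleftrightarrow> strict_antimono_on (G x) h \<and> h ` G x = H x \<and>
      (\<forall>z \<in> G x. h (\<phi> z) = \<phi> (h z)) \<and> (p \<in> G x \<longrightarrow> h p = M \<and> h m = n)" for x h
  have good: "\<exists>h. good x h" if x: "x < \<xi>" "\<phi> x \<noteq> x" for x
  proof -
    obtain y where y: "R x y" using R1[OF x] by blast
    have Gx: "z \<in> G x \<longleftrightarrow> R z y" for z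
      using y Rtrans unfolding G_def H_def by blast
    have Hx: "z \<in> H x \<longleftrightarrow> R x z" for z by (simp add: H_def)
    have convG: "is_interval (G x)" unfolding is_interval_1 Ball_def Gx using Rconv1 by blast
    have convH: "is_interval (H x)" unfolding is_interval_1 Ball_def Hx using Rconv2 by blast
    have invG: "\<phi> -` G x = G x" by (auto simp: Gx Rinv1)
    have invH: "\<phi> -` H x = H x" by (auto simp: Hx Rinv2)
    have opp': "\<forall>u \<in> G x. \<forall>w \<in> H x. (\<phi> u - u) * (\<phi> w - w) < 0"
      using opp unfolding G_def by blast
    show ?thesis
    proof (cases "p \<in> G x")
      case False
      then show ?thesis
        using gap_conjugacy_unoriented[OF sm su convG convH invG invH opp' mem[OF x], of y] y Hx
        unfolding good_def by metis
    next
      case True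
      then have M: "M \<in> H x" using base(1) y Rtrans unfolding Gx Hx by blast
      have down: "\<forall>w \<in> H x. \<phi> w < w"
        using opp' True base(2) by (auto simp: mult_less_0_iff)
      have up: "\<forall>u \<in> G x. u < \<phi> u"
      proof
        fix u assume "u \<in> G x"
        then have "(\<phi> u - u) * (\<phi> M - M) < 0" using opp' M by blast
        then show "u < \<phi> u" using down M by (auto simp: mult_less_0_iff)
      qed
      show ?thesis
        using gap_conjugacy[OF sm su convG convH invG invH up down True M mn]
        unfolding good_def by metis
    qed
  qed
  \<comment> \<open>A single conjugacy per gap is selected here: for \<open>z\<close> in the gap
    \<open>G x\<close> the predicates \<open>good z\<close> and \<open>good x\<close> coincide, so
    the choice operator returns the same function for both.\<close>
  define h where "h x = (if \<phi> x = x then \<omega> x else (SOME h. good x h) x)" for x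
  have hgap: "\<exists>k. good x k \<and> (\<forall>z \<in> G x. h z = k z)" if x: "x < \<xi>" "\<phi> x \<noteq> x" for x
  proof -
    have "good x (SOME h. good x h)" by (rule someI_ex[OF good[OF x]])
    moreover have "h z = (SOME h. good x h) z" if "z \<in> G x" for z
    proof -
      obtain y where y: "R x y" using R1[OF x] by blast
      then have z: "R z y" using that by (simp add: G_def H_def)
      then have "good z = good x" unfolding good_def Geq[OF y z] by blast
      moreover have "\<phi> z \<noteq> z" using z by (simp add: R_def)
      ultimately show ?thesis by (simp add: h_def)
    qed
    ultimately show ?thesis by blast
  qed
  have hR: "R x (h x)" if x: "x < \<xi>" "\<phi> x \<noteq> x" for x
  proof -
    obtain k where "good x k" "h x = k x" using hgap[OF x] mem[OF x] by blast
    then have "h x \<in> H x" using mem[OF x] unfolding good_def by blast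
    then show ?thesis by (simp add: H_def)
  qed
  have hfix: "h z = \<omega> z" if "\<phi> z = z" for z using that by (simp add: h_def)
  have hcomm: "h (\<phi> x) = \<phi> (h x)" if "x \<le> \<xi>" for x
  proof (cases "\<phi> x = x")
    case True
    then show ?thesis using hfix \<omega>fix that by simp
  next
    case False
    then have x: "x < \<xi>" using that \<xi> by (cases "x = \<xi>") auto
    obtain k where k: "good x k" "\<And>z. z \<in> G x \<Longrightarrow> h z = k z" using hgap[OF x False] by blast
    have "\<phi> x \<in> G x" using mem[OF x False] Rinv1 by (simp add: G_def)
    then show ?thesis using k mem[OF x False] unfolding good_def by simp
  qed
  \<comment> \<open>Points separated by a fixed point are compared through it, so
    \<open>hcut\<close> reduces the monotonicity of \<open>h\<close> to pairs within one
    gap.\<close>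
  have hcut: "z < x \<longleftrightarrow> h x < \<omega> z" "x < z \<longleftrightarrow> \<omega> z < h x" if "\<phi> z = z" "z \<le> \<xi>" "x \<le> \<xi>" for x z
  proof -
    have "(z < x \<longleftrightarrow> h x < \<omega> z) \<and> (x < z \<longleftrightarrow> \<omega> z < h x)"
    proof (cases "\<phi> x = x")
      case True
      then show ?thesis using hfix strict_antimono_on_eq[OF \<omega>(1)] that by auto
    next
      case False
      then have "x < \<xi>" using that \<xi> by (cases "x = \<xi>") auto
      then have "R x (h x)" using hR False by blast
      then show ?thesis using that \<omega>fix[OF that(1,2)] False unfolding R_def
        by (metis linorder_neqE_linordered_idom order_less_asym)
    qed
    then show "z < x \<longleftrightarrow> h x < \<omega> z" "x < z \<longleftrightarrow> \<omega> z < h x" by auto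
  qed
  have hanti: "strict_antimono_on {..\<xi>} h"
  proof (rule monotone_onI)
    fix x y assume xy: "x \<in> {..\<xi>}" "y \<in> {..\<xi>}" "x < y"
    show "h y < h x"
    proof (cases "\<exists>z. \<phi> z = z \<and> x \<le> z \<and> z \<le> y")
      case True
      then obtain z where z: "\<phi> z = z" "x \<le> z" "z \<le> y" by blast
      then have "z \<le> \<xi>" using xy by simp
      then show ?thesis using hcut[OF z(1), of x] hcut[OF z(1), of y] xy z by (smt (verit) atMost_iff)
    next
      case False
      then have nofix: "\<phi> z \<noteq> z" if "x \<le> z" "z \<le> y" for z using that by blast
      have x: "x < \<xi>" "\<phi> x \<noteq> x" and y: "\<phi> y \<noteq> y"
        using xy nofix[of x] nofix[of y] by auto
      obtain w where w: "R x w" using R1[OF x] by blast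
      have y\<xi>: "y < \<xi>" using xy y \<xi> by (cases "y = \<xi>") auto
      have "\<forall>z. \<phi> z = z \<longrightarrow> (z < x \<longleftrightarrow> z < y)" using False xy(3) by (meson less_le_trans less_imp_le not_less)
      then have "R y w" using w y y\<xi> unfolding R_def by blast
      then have "y \<in> G x" using w Rtrans unfolding G_def H_def by blast
      then show ?thesis using hgap[OF x] mem[OF x] xy(3) unfolding good_def
        by (metis monotone_onD)
    qed
  qed
  have hsurj: "h ` {..\<xi>} = {\<xi>..}"
  proof (intro equalityI subsetI)
    fix y assume "y \<in> h ` {..\<xi>}"
    then obtain x where "x \<le> \<xi>" "y = h x" by auto
    then show "y \<in> {\<xi>..}" using hcut(1)[OF \<xi>(1) order_refl, of x] \<xi>(2) by auto
  next
    fix y assume y: "y \<in> {\<xi>..}"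
    show "y \<in> h ` {..\<xi>}"
    proof (cases "\<phi> y = y")
      case True
      then obtain z where "\<phi> z = z" "z \<le> \<xi>" "y = \<omega> z" using y \<omega>(2) by force
      then show ?thesis using hfix by (metis atMost_iff imageI)
    next
      case False
      then have "\<xi> < y" using y \<xi> by (cases "y = \<xi>") auto
      then obtain x where R: "R x y" using R2 False by blast
      then have x: "x < \<xi>" "\<phi> x \<noteq> x" by (auto simp: R_def)
      obtain k where k: "good x k" "\<And>z. z \<in> G x \<Longrightarrow> h z = k z" using hgap[OF x] by blast
      have "y \<in> k ` G x" using k(1) R unfolding good_def H_def by blast
      then obtain z where z: "z \<in> G x" "y = k z" by blast
      moreover have "z < \<xi>" using z(1) R unfolding G_def H_def R_def by blast
      ultimately show ?thesis using k(2) by (auto intro!: image_eqI[of _ _ z])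
    qed
  qed
  have hpm: "h p = M" "h m = n" "m \<le> \<xi>" "p \<le> \<xi>"
  proof -
    have p: "p < \<xi>" "\<phi> p \<noteq> p" using base by (auto simp: R_def)
    have pG: "p \<in> G p" "\<phi> p \<in> G p" using mem[OF p] Rinv1 by (auto simp: G_def)
    have "R m M"
      by (rule Rconv1[OF base(1), of "\<phi> p"]) (use mn base Rinv1 in auto)
    then have "m \<in> G p" using base(1) Rtrans unfolding G_def H_def by blast
    then show "h p = M" "h m = n" using hgap[OF p] pG unfolding good_def by auto
    show "p \<le> \<xi>" using p by simp
    show "m \<le> \<xi>" using \<open>R m M\<close> by (simp add: R_def)
  qed
  note hinj = inj_on_strict_antimono_on[OF hanti]
  define hi where "hi = the_inv_into {..\<xi>} h"
  have hi: "hi (h x) = x" if "x \<le> \<xi>" for x using hinj that by (simp add: hi_def the_inv_into_f_f)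
  have hhi: "h (hi y) = y" "hi y \<le> \<xi>" if "\<xi> \<le> y" for y
    using hsurj that hi by (force simp: image_iff set_eq_iff)+
  have h\<xi>: "h \<xi> = \<xi>" using hfix \<xi> by simp
  define g where "g x = (if x \<le> \<xi> then h x else hi (\<phi> x))" for x
  have g1: "g x = h x" "\<xi> \<le> g x" if "x \<le> \<xi>" for x using that hsurj by (auto simp: g_def)
  have hi\<xi>: "hi \<xi> = \<xi>" using hi[of \<xi>] h\<xi> by simp
  have g2: "g x = hi (\<phi> x)" "g x \<le> \<xi>" if "\<xi> \<le> x" for x
    using that hhi(2)[of "\<phi> x"] fixless[OF \<xi>(1), of x] \<xi> hi\<xi> h\<xi>
    by (auto simp: g_def order_antisym_conv not_le order_le_less)
  have \<phi>\<xi>: "\<phi> x \<le> \<xi>" if "x \<le> \<xi>" for x using that fixless[OF \<xi>(1), of x] by force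
  have \<phi>\<xi>': "\<xi> \<le> \<phi> x" if "\<xi> \<le> x" for x using that fixless[OF \<xi>(1), of x] by force
  have root: "g (g x) = \<phi> x" for x
  proof (cases "x \<le> \<xi>")
    case True
    have "g (g x) = hi (h (\<phi> x))" using g1[OF True] g2 hcomm[OF True] by simp
    then show ?thesis using hi \<phi>\<xi>[OF True] by simp
  next
    case False
    then show ?thesis using g1 g2 hhi \<phi>\<xi>'[of x] by simp
  qed
  have hi_anti: "hi y < hi x" if "\<xi> \<le> x" "x < y" for x y
    using strict_antimono_on_eq(1)[OF hanti, of "hi x" "hi y"] hhi[of x] hhi[of y] that by simp
  show thesis
  proof (rule that)
    show "strict_antimono_on UNIV g"
    proof (rule monotone_onI)
      fix x y :: real assume xy: "x < y"
      consider "y \<le> \<xi>" | "x \<le> \<xi>" "\<xi> < y" | "\<xi> < x" by linarith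
      then show "g y < g x"
      proof cases
        case 1
        then show ?thesis using xy hanti g1 by (simp add: monotone_on_def)
      next
        case 2
        then have "\<xi> < \<phi> y" using fixless[OF \<xi>(1)] by simp
        then show ?thesis using 2 hi_anti[of \<xi> "\<phi> y"] hi\<xi> g1[of x] g2[of y] by simp
      next
        case 3
        then show ?thesis using xy hi_anti[of "\<phi> x" "\<phi> y"] \<phi>\<xi>'[of x] g2 by simp
      qed
    qed
    show "surj g"
    proof (rule surjI)
      show "g (g (inv \<phi> y)) = y" for y using root su by (simp add: surj_f_inv_f)
    qed
    show "g p = M" using g1(1)[OF hpm(4)] hpm(1) by (rule trans)
    show "g m = n" using g1(1)[OF hpm(3)] hpm(2) by (rule trans)
    show "g (g x) = \<phi> x" for x by (rule root)
  qed
qed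

lemma consecutive_in_around:
  assumes "closed X" "x \<notin> X" "z1 \<in> X" "z1 < x" "z2 \<in> X" "x < z2"
  obtains u v where "consecutive_in X u v" "u < x" "x < v"
proof -
  define u v where "u = Sup (X \<inter> {..x})" and "v = Inf (X \<inter> {x..})"
  have bdd: "bdd_above (X \<inter> {..x})" "bdd_below (X \<inter> {x..})" by auto
  have ne: "X \<inter> {..x} \<noteq> {}" "X \<inter> {x..} \<noteq> {}" using assms by force+
  have "u \<in> X \<inter> {..x}" unfolding u_def
    by (rule closed_contains_Sup[OF ne(1) bdd(1)]) (simp add: assms closed_Int)
  moreover have "v \<in> X \<inter> {x..}" unfolding v_def
    by (rule closed_contains_Inf[OF ne(2) bdd(2)]) (simp add: assms closed_Int)
  moreover have "z \<le> u" if "z \<in> X" "z \<le> x" for z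
    unfolding u_def using that by (intro cSup_upper[OF _ bdd(1)]) auto
  moreover have "v \<le> z" if "z \<in> X" "x \<le> z" for z
    unfolding v_def using that by (intro cInf_lower[OF _ bdd(2)]) auto
  ultimately show thesis
    using that[of u v] assms(2) unfolding consecutive_in_def
    by (smt (verit) Int_iff atLeast_iff atMost_iff disjoint_iff greaterThanLessThan_iff)
qed

text \<open>The shifts agree with \<open>F\<close> at \<open>p\<close> and \<open>q\<close>, and the
  two rays cover what the range of \<open>F\<close> on the interval misses. A nonzero shift has no
  fixed point, so none is added when \<open>p < F p\<close> and \<open>F q < q\<close>, the case of
  interest.\<close>

lemma translate_extension:
  fixes F :: "real \<Rightarrow> real"
  assumes "continuous_on {p..q} F" "strict_mono_on {p..q} F" "p < q"
  defines "\<phi> \<equiv> \<lambda>x. if x < p then x + (F p - p) else if q < x then x + (F q - q) else F x"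
  shows "strict_mono \<phi>" "surj \<phi>"
proof -
  have F: "F x < F y" if "p \<le> x" "x < y" "y \<le> q" for x y
    using strict_mono_onD[OF assms(2)] that by auto
  have F': "F x \<le> F y" if "p \<le> x" "x \<le> y" "y \<le> q" for x y
    using F[of x y] that by (cases "x = y") auto
  show "strict_mono \<phi>"
  proof (rule strict_monoI)
    fix x y :: real assume "x < y"
    then show "\<phi> x < \<phi> y"
      using F[of x y] F'[of p y] F'[of x q] F'[of p q] assms(3) by (auto simp: \<phi>_def)
  qed
  show "surj \<phi>" unfolding surj_def
  proof
    fix y
    consider "y < F p" | "F p \<le> y" "y \<le> F q" | "F q < y" by linarith
    then show "\<exists>x. y = \<phi> x"
    proof cases
      case 1
      then show ?thesis by (intro exI[of _ "y - (F p - p)"]) (simp add: \<phi>_def)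
    next
      case 2
      then obtain x where "p \<le> x" "x \<le> q" "F x = y" using IVT'[of F p y q] assms by auto
      then show ?thesis by (intro exI[of _ x]) (simp add: \<phi>_def)
    next
      case 3
      then show ?thesis using assms(3) by (intro exI[of _ "y - (F q - q)"]) (simp add: \<phi>_def)
    qed
  qed
qed

text \<open>The three alternatives for \<open>(m, M)\<close> are those of the theorem; each places \<open>m\<close> in
  \<open>[p, F p]\<close> exactly as \<open>F q\<close> is placed in \<open>[F M, M]\<close>, two fundamental domains that the
  conjugacy has to match.\<close>

lemma reversing_correspondence_root:
  fixes F :: "real \<Rightarrow> real"
  assumes rc: "reversing_correspondence p q F" and pq: "p < q" "p < F p" "F q < q"
    and mM: "m = p \<and> M = F q \<or> m = F p \<and> M = q \<or> p < m \<and> m < F p \<and> F q < M \<and> M < q"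
  obtains g where "strict_antimono_on UNIV g" "surj g" "\<And>x. x \<in> {p..q} \<Longrightarrow> g (g x) = F x"
    "g p = M" "g q = m"
proof -
  define X where "X = Fix_on {p..q} F"
  have cont: "continuous_on {p..q} F" and sm: "strict_mono_on {p..q} F"
    using rc by (auto simp: reversing_correspondence_def)
  obtain \<xi> \<omega> where \<xi>: "\<xi> \<in> X" "\<omega> \<xi> = \<xi>" and \<omega>: "strict_antimono_on X \<omega>" "\<omega> ` X = X"
    and sign: "\<And>u v x y. consecutive_in X u v \<Longrightarrow> v \<le> \<xi> \<Longrightarrow> x \<in> {u<..<v} \<Longrightarrow>
      y \<in> {\<omega> v<..<\<omega> u} \<Longrightarrow> (F x - x) * (F y - y) < 0"
    using rc unfolding reversing_correspondence_def Let_def X_def by blast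
  define \<phi> where "\<phi> x = (if x < p then x + (F p - p) else if q < x then x + (F q - q) else F x)" for x
  have \<phi>: "strict_mono \<phi>" "surj \<phi>"
    unfolding \<phi>_def using translate_extension[OF cont sm pq(1)] by blast+
  have \<phi>F: "\<phi> x = F x" if "x \<in> {p..q}" for x using that by (simp add: \<phi>_def)
  have X: "z \<in> X \<longleftrightarrow> \<phi> z = z" for z using pq by (auto simp: X_def Fix_on_def \<phi>_def)
  have Xpq: "p < z \<and> z < q" if "z \<in> X" for z
    using that pq by (cases "z = p"; cases "z = q"; auto simp: X_def Fix_on_def)
  have "closed X"
  proof -
    have "X = {p..q} \<inter> (\<lambda>x. F x - x) -` {0}" by (auto simp: X_def Fix_on_def)
    then show ?thesis
      using continuous_closed_preimage[OF continuous_on_diff[OF cont continuous_on_id], of "{0}"] by simp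
  qed
  note \<omega>less = strict_antimono_on_eq[OF \<omega>(1)]
  have \<omega>X: "\<omega> z \<in> X" if "z \<in> X" for z using imageI[OF that, of \<omega>] \<omega>(2) by simp
  have \<omega>surj: "\<exists>w \<in> X. z = \<omega> w" if "z \<in> X" for z
    using that \<omega>(2) by (metis imageE)
  have \<omega>\<xi>: "\<xi> \<le> \<omega> z \<longleftrightarrow> z \<le> \<xi>" if "z \<in> X" for z
    using \<omega>less(1)[OF that \<xi>(1)] \<xi>(2) by auto
  \<comment> \<open>Hence \<open>M\<close> lies beyond all fixed points, in the unbounded gap that
    is matched with the gap of \<open>p\<close>.\<close>
  have XM: "z < M" if "z \<in> X" for z
  proof -
    have "z = F z" using that by (simp add: X_def Fix_on_def)
    also have "F z < F q" using strict_mono_onD[OF sm, of z q] Xpq[OF that] pq by simp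
    also have "F q \<le> M" using mM pq by auto
    finally show ?thesis .
  qed
  define R where "R x y \<longleftrightarrow> x < \<xi> \<and> \<xi> < y \<and> \<phi> x \<noteq> x \<and> \<phi> y \<noteq> y \<and>
    (\<forall>z \<le> \<xi>. \<phi> z = z \<longrightarrow> (z < x \<longleftrightarrow> y < \<omega> z))" for x y
  have consD: "u \<in> X" "v \<in> X" "u < v" "\<And>z. z \<in> X \<Longrightarrow> z \<le> u \<or> v \<le> z" if "consecutive_in X u v" for u v
    using that unfolding consecutive_in_def by force+
  have inner: "R x y" if "consecutive_in X u v" "v \<le> \<xi>" "u < x" "x < v" "\<omega> v < y" "y < \<omega> u" for u v x y
  proof -
    note uv = consD(1,2,4)[OF that(1)]
    have "y \<notin> X"
    proof
      assume "y \<in> X"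
      then obtain w where "w \<in> X" "y = \<omega> w" using \<omega>surj by blast
      then show False using uv(3)[of w] that \<omega>less uv by force
    qed
    moreover have "\<xi> \<le> \<omega> v" using \<omega>\<xi> uv that by blast
    moreover have "z < x \<longleftrightarrow> y < \<omega> z" if "z \<in> X" for z
      using uv(3)[OF that] \<omega>less(1)[OF that uv(1)] \<omega>less(1)[OF that uv(2)]
        \<omega>less(1)[OF uv(1) that] \<omega>less(1)[OF uv(2) that]
        \<open>u < x\<close> \<open>x < v\<close> \<open>\<omega> v < y\<close> \<open>y < \<omega> u\<close> by linarith
    moreover have "x \<notin> X" using uv(3) that by force
    ultimately show ?thesis using that X unfolding R_def by auto
  qed
  have outer: "R x y" if "x < \<xi>" "\<xi> < y" "\<And>z. z \<in> X \<Longrightarrow> x < z" "\<And>z. z \<in> X \<Longrightarrow> z < y" for x y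
  proof -
    have "x \<notin> X" "y \<notin> X" using that by blast+
    then show ?thesis using that X \<omega>X unfolding R_def by (metis less_asym)
  qed
  have p: "p < \<xi>" "\<And>z. z \<in> X \<Longrightarrow> p < z" using Xpq \<xi> by auto
  have base: "R p M" using outer p XM \<xi>(1) by blast
  have R1: "\<exists>y. R x y" if x: "x < \<xi>" "\<phi> x \<noteq> x" for x
  proof (cases "\<exists>z \<in> X. z < x")
    case True
    then obtain u v where uv: "consecutive_in X u v" "u < x" "x < v"
      using consecutive_in_around[OF \<open>closed X\<close>] x X \<xi> by metis
    then have uv': "u \<in> X" "v \<in> X" "u < v" "v \<le> \<xi>"
      using consD[OF uv(1)] consD(4)[OF uv(1) \<xi>(1)] x by auto
    then have "\<omega> v < \<omega> u" using \<omega>less by simp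
    then obtain y where "\<omega> v < y" "y < \<omega> u" using dense by blast
    then show ?thesis using inner uv uv'(4) by blast
  next
    case False
    then have "x < z" if "z \<in> X" for z using that x X by (metis linorder_neqE_linordered_idom)
    then show ?thesis using outer x XM \<xi>(1) by blast
  qed
  have R2: "\<exists>x. R x y" if y: "\<xi> < y" "\<phi> y \<noteq> y" for y
  proof (cases "\<exists>z \<in> X. y < z")
    case True
    then obtain s t where st: "consecutive_in X s t" "s < y" "y < t"
      using consecutive_in_around[OF \<open>closed X\<close>] y X \<xi> by metis
    then have st': "s \<in> X" "t \<in> X" "s < t" "\<xi> \<le> s"
      using consD[OF st(1)] consD(4)[OF st(1) \<xi>(1)] y by auto
    obtain u v where uv: "u \<in> X" "v \<in> X" "\<omega> v = s" "\<omega> u = t" using \<omega>surj[OF st'(1)] \<omega>surj[OF st'(2)] by metis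
    then have "u < v" "v \<le> \<xi>" using st' \<omega>less \<omega>\<xi> by auto
    moreover have "consecutive_in X u v"
    proof -
      have False if "z \<in> X" "u < z" "z < v" for z
      proof -
        have "s < \<omega> z" "\<omega> z < t" using that uv \<omega>less by auto
        then show False using st(1) \<omega>X[OF that(1)] unfolding consecutive_in_def by force
      qed
      then show ?thesis using uv \<open>u < v\<close> unfolding consecutive_in_def by force
    qed
    moreover obtain x where "u < x" "x < v" using dense[OF \<open>u < v\<close>] by blast
    ultimately show ?thesis using inner st uv by blast
  next
    case False
    then have "z < y" if "z \<in> X" for z using that y X by (metis linorder_neqE_linordered_idom)
    then show ?thesis using outer y p by blast
  qed
  have opp: "(\<phi> x - x) * (\<phi> y - y) < 0" if R: "R x y" for x y
  proof (cases "\<exists>z \<in> X. z < x")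
    case True
    have x: "x < \<xi>" "x \<notin> X" and y: "y \<notin> X" using R X unfolding R_def by auto
    then obtain u v where uv: "consecutive_in X u v" "u < x" "x < v"
      using consecutive_in_around[OF \<open>closed X\<close>] True \<xi> by metis
    then have uv': "u \<in> X" "v \<in> X" "u \<le> \<xi>" "v \<le> \<xi>"
      using consD[OF uv(1)] consD(4)[OF uv(1) \<xi>(1)] x by auto
    have "y < \<omega> u" "\<omega> v < y"
      using R uv uv' X y \<omega>X[OF uv'(2)] unfolding R_def by (metis less_asym linorder_neqE_linordered_idom)+
    moreover have "x \<in> {p..q}" "y \<in> {p..q}"
      using uv Xpq[OF uv'(1)] Xpq[OF uv'(2)] Xpq[OF \<omega>X[OF uv'(1)]] Xpq[OF \<omega>X[OF uv'(2)]] calculation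
      by auto
    ultimately show ?thesis using sign[OF uv(1) uv'(4)] uv \<phi>F by simp
  next
    case False
    have xy: "x < \<xi>" "\<xi> < y" "x \<notin> X" "y \<notin> X" using R X unfolding R_def by auto
    have Xy: "\<not> y < z" if z: "z \<in> X" for z
    proof
      assume "y < z"
      obtain w where w: "w \<in> X" "z = \<omega> w" using \<omega>surj z by blast
      then have "w \<le> \<xi>" using \<omega>\<xi>[OF w(1)] w(2) \<open>y < z\<close> xy by simp
      then show False using R w X \<open>y < z\<close> False unfolding R_def by blast
    qed
    \<comment> \<open>Here \<open>x\<close> and \<open>y\<close> lie beyond all fixed points, where
      the sign condition for consecutive fixed points says nothing. The signs come from
      \<open>p < F p\<close> and \<open>F q < q\<close> instead: a change of sign would produce a
      further fixed point.\<close>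
    have "x < \<phi> x"
    proof (rule ccontr)
      assume no: "\<not> x < \<phi> x"
      then have px: "p \<le> x" using pq by (auto simp: \<phi>_def split: if_splits)
      then have xq: "x \<le> q" using xy(1) Xpq[OF \<xi>(1)] by simp
      have "\<exists>z\<ge>p. z \<le> x \<and> F z - z = 0"
        by (rule IVT2') (use no px xq pq \<phi>F in \<open>auto intro!: continuous_intros continuous_on_subset[OF cont]\<close>)
      then obtain z where "z \<in> X" "z \<le> x" using xq by (auto simp: X_def Fix_on_def)
      then show False using False xy by force
    qed
    moreover have "\<phi> y < y"
    proof (rule ccontr)
      assume no: "\<not> \<phi> y < y"
      then have yq: "y \<le> q" using pq by (auto simp: \<phi>_def split: if_splits)
      then have py: "p \<le> y" using xy(2) Xpq[OF \<xi>(1)] by simp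
      have "\<exists>z\<ge>y. z \<le> q \<and> F z - z = 0"
        by (rule IVT2') (use no py yq pq \<phi>F in \<open>auto intro!: continuous_intros continuous_on_subset[OF cont]\<close>)
      then obtain z where "z \<in> X" "y \<le> z" using py by (auto simp: X_def Fix_on_def)
      then show False using Xy xy by force
    qed
    ultimately show ?thesis by (simp add: mult_less_0_iff)
  qed
  have im: "\<omega> ` {z. \<phi> z = z \<and> z \<le> \<xi>} = {z. \<phi> z = z \<and> \<xi> \<le> z}"
  proof -
    have "{z. \<phi> z = z \<and> \<xi> \<le> z} \<subseteq> \<omega> ` {z. \<phi> z = z \<and> z \<le> \<xi>}"
    proof
      fix z assume "z \<in> {z. \<phi> z = z \<and> \<xi> \<le> z}"
      then have z: "z \<in> X" "\<xi> \<le> z" using X by auto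
      then obtain w where "w \<in> X" "z = \<omega> w" using \<omega>surj by blast
      then show "z \<in> \<omega> ` {z. \<phi> z = z \<and> z \<le> \<xi>}" using \<omega>\<xi> z X by blast
    qed
    then show ?thesis using \<omega>X \<omega>\<xi> X by auto
  qed
  have anti: "strict_antimono_on {z. \<phi> z = z \<and> z \<le> \<xi>} \<omega>"
    by (rule monotone_on_subset[OF \<omega>(1)]) (use X in auto)
  have Mq: "M \<le> q" "p \<le> M" using mM pq XM[OF \<xi>(1)] Xpq[OF \<xi>(1)] by auto
  \<comment> \<open>The condition \<open>g q = m\<close> is replaced by \<open>g m = F q\<close>,
    from which it will follow by cancelling \<open>g\<close> in \<open>g (g q) = F q\<close>. In the
    third alternative, \<open>\<phi> M < F q\<close> comes from \<open>M < q\<close>.\<close>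
  have mn: "m = p \<and> F q = M \<or> m = \<phi> p \<and> F q = \<phi> M \<or>
      p < m \<and> m < \<phi> p \<and> \<phi> M < F q \<and> F q < M"
    using mM pq Mq strict_mono_onD[OF sm, of M q] by (auto simp: \<phi>_def)
  have p\<phi>: "p < \<phi> p" using pq by (auto simp: \<phi>_def)
  have \<xi>\<phi>: "\<phi> \<xi> = \<xi>" using \<xi>(1) X by blast
  obtain g where g: "strict_antimono_on UNIV g" "surj g" "\<And>x. g (g x) = \<phi> x"
    "g p = M" "g m = F q"
    using decreasing_root[OF \<phi> \<xi>\<phi> \<xi>(2) anti im, folded R_def, OF R1 R2 opp base p\<phi> mn] by blast
  have "g (g q) = g m" using g(3,5) \<phi>F pq by simp
  then have "g q = m" using strict_antimono_on_eq(2)[OF g(1)] by blast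
  then show thesis using that g \<phi>F by simp
qed

section \<open>Forts\<close>

lemma strictly_monotone_on_imp_inj_on:
  "strictly_monotone_on S F \<Longrightarrow> inj_on F S"
  unfolding strictly_monotone_on_def
  using strict_mono_on_imp_inj_on inj_on_strict_antimono_on by blast

text \<open>Injectivity, unlike monotonicity, passes at once from a composition to its inner map;
  this is how the forts of a root are compared with those of \<open>F\<close>.\<close>

lemma strictly_monotone_on_iff_inj_on:
  "is_interval S \<Longrightarrow> continuous_on S F \<Longrightarrow> strictly_monotone_on S F \<longleftrightarrow> inj_on F S"
  unfolding strictly_monotone_on_def by (simp add: injective_eq_monotone_map)

lemma strictly_monotone_on_subset:
  "strictly_monotone_on T F \<Longrightarrow> S \<subseteq> T \<Longrightarrow> strictly_monotone_on S F"
  unfolding strictly_monotone_on_def by (meson monotone_on_subset)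

lemma strictly_monotone_on_between:
  assumes "strictly_monotone_on S F" "x \<in> S" "y \<in> S" "z \<in> S" "x < y" "y < z"
  shows "F x < F y \<and> F y < F z \<or> F z < F y \<and> F y < F x"
  using assms unfolding strictly_monotone_on_def by (meson monotone_onD)

lemma forts_cong: "(\<And>x. x \<in> {a..b} \<Longrightarrow> F x = G x) \<Longrightarrow> forts a b F = forts a b G"
  unfolding forts_def strictly_monotone_on_def monotone_on_def by auto

lemma forts_id: "forts a b (\<lambda>x. x) = {}"
  unfolding forts_def strictly_monotone_on_def monotone_on_def by auto

lemma not_fortD:
  assumes "x \<in> {a<..<b}" "x \<notin> forts a b F"
  obtains e where "0 < e" "{x - e..x + e} \<subseteq> {a..b}" "strictly_monotone_on {x - e..x + e} F"
proof -
  obtain U where U: "open U" "x \<in> U" "strictly_monotone_on (U \<inter> {a..b}) F"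
    using assms unfolding forts_def by blast
  then have "open (U \<inter> {a<..<b})" "x \<in> U \<inter> {a<..<b}" using assms by auto
  then obtain e where e: "0 < e" "cball x e \<subseteq> U \<inter> {a<..<b}" by (meson open_contains_cball)
  then have sub: "{x - e..x + e} \<subseteq> U \<inter> {a<..<b}" by (simp add: cball_eq_atLeastAtMost)
  moreover have "U \<inter> {a<..<b} \<subseteq> U \<inter> {a..b}" by auto
  ultimately show thesis
    using that[OF e(1)] strictly_monotone_on_subset[OF U(3)] by (meson Int_subset_iff order_trans)
qed

lemma fort_not_monotone:
  assumes "z \<in> forts a b F" "u < z" "z < v"
  shows "\<not> strictly_monotone_on {u..v} F"
proof
  assume "strictly_monotone_on {u..v} F"
  then have "strictly_monotone_on ({u<..<v} \<inter> {a..b}) F"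
    by (rule strictly_monotone_on_subset) auto
  then show False using assms unfolding forts_def by force
qed

lemma turning_point_fort:
  assumes "strict_mono_on {u..z} f" "strict_antimono_on {z..v} f" "u < z" "z < v" "a \<le> u" "v \<le> b"
  shows "z \<in> forts a b f"
proof (rule ccontr)
  assume "z \<notin> forts a b f"
  then obtain e where e: "0 < e" "strictly_monotone_on {z - e..z + e} f"
    using not_fortD[of z a b f] assms by auto
  let ?d = "min e (min (z - u) (v - z))"
  have "?d > 0" using e assms by simp
  then have "f (z - ?d) < f z" "f (z + ?d) < f z"
    using strict_mono_onD[OF assms(1), of "z - ?d" z] monotone_onD[OF assms(2), of z "z + ?d"] assms(3,4)
    by (auto simp: min_def split: if_splits)
  moreover have "z - ?d \<in> {z - e..z + e}" "z \<in> {z - e..z + e}" "z + ?d \<in> {z - e..z + e}"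
    using e(1) \<open>?d > 0\<close> by auto
  ultimately show False
    using strictly_monotone_on_between[OF e(2), of "z - ?d" z "z + ?d"] \<open>?d > 0\<close> by linarith
qed

text \<open>If \<open>F\<close> takes the same value at \<open>x\<close> and \<open>y\<close>, it
  has an extremum strictly between them, as in Rolle's theorem. No neighbourhood of an extremum is
  mapped strictly monotonically, so it would be a fort. Thus \<open>F\<close> is injective, and
  continuity gives monotonicity.\<close>

lemma fort_free_imp_strictly_monotone:
  assumes "continuous_on {u..v} F" "{u..v} \<subseteq> {a..b}" "{u<..<v} \<inter> forts a b F = {}"
  shows "strictly_monotone_on {u..v} F"
proof -
  have False if xy: "x \<in> {u..v}" "y \<in> {u..v}" "x < y" "F x = F y" for x y
  proof -
    have cont: "continuous_on {x..y} F"
      by (rule continuous_on_subset[OF assms(1)]) (use xy in auto)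
    obtain s where s: "s \<in> {x..y}" "\<And>w. w \<in> {x..y} \<Longrightarrow> F w \<le> F s"
      using continuous_attains_sup[OF compact_Icc _ cont] xy(3) by (metis atLeastatMost_empty_iff2 less_imp_le not_less)
    obtain i where i: "i \<in> {x..y}" "\<And>w. w \<in> {x..y} \<Longrightarrow> F i \<le> F w"
      using continuous_attains_inf[OF compact_Icc _ cont] xy(3) by (metis atLeastatMost_empty_iff2 less_imp_le not_less)
    have "\<exists>z. x < z \<and> z < y \<and> ((\<forall>w \<in> {x..y}. F w \<le> F z) \<or> (\<forall>w \<in> {x..y}. F z \<le> F w))"
    proof (cases "s \<in> {x<..<y} \<or> i \<in> {x<..<y}")
      case True
      then show ?thesis using s(2) i(2) by (meson greaterThanLessThan_iff)
    next
      case False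
      then have "(s = x \<or> s = y) \<and> (i = x \<or> i = y)" using s(1) i(1) by auto
      \<comment> \<open>With both extrema at the ends and equal values there, \<open>F\<close> is
        constant on the segment, and its midpoint serves as the extremum.\<close>
      then have const: "F w = F x" if "w \<in> {x..y}" for w
        using s(2)[OF that] i(2)[OF that] xy(4) by (metis order_antisym)
      have "F w = F ((x + y) / 2)" if "w \<in> {x..y}" for w
        using const[OF that] const[of "(x + y) / 2"] xy(3) by auto
      then have "\<forall>w \<in> {x..y}. F w \<le> F ((x + y) / 2)" by (metis order_refl)
      then show ?thesis using xy(3) by (intro exI[of _ "(x + y) / 2"] conjI disjI1) simp_all
    qed
    then obtain z where z: "x < z" "z < y"
      "(\<forall>w \<in> {x..y}. F w \<le> F z) \<or> (\<forall>w \<in> {x..y}. F z \<le> F w)" by blast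
    have ab: "a \<le> u" "v \<le> b" using assms(2) xy by auto
    have "z \<in> {u<..<v}" using z(1,2) xy(1,2) by simp
    then have "z \<in> {a<..<b}" "z \<notin> forts a b F" using ab assms(3) by auto
    then obtain e where e: "0 < e" "strictly_monotone_on {z - e..z + e} F" using not_fortD by metis
    let ?d = "min e (min (z - x) (y - z))"
    have "?d > 0" using e z by simp
    moreover have "z - ?d \<in> {z - e..z + e}" "z \<in> {z - e..z + e}" "z + ?d \<in> {z - e..z + e}"
      using e(1) \<open>?d > 0\<close> by auto
    ultimately have "F (z - ?d) < F z \<and> F z < F (z + ?d) \<or> F (z + ?d) < F z \<and> F z < F (z - ?d)"
      by (intro strictly_monotone_on_between[OF e(2)]) simp_all
    moreover have "z - ?d \<in> {x..y}" "z + ?d \<in> {x..y}"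
      using \<open>?d > 0\<close> z(1,2) by auto
    ultimately show False using z(3) by (meson not_less)
  qed
  then have "inj_on F {u..v}" by (intro inj_onI) (metis linorder_less_linear)
  then show ?thesis
    using strictly_monotone_on_iff_inj_on[OF _ assms(1)] by simp
qed

text \<open>Where the composition of \<open>f\<close> with itself is injective, so is
  \<open>f\<close>; by continuity \<open>f\<close> is then strictly monotone there.\<close>

lemma forts_subset_of_iterative_root:
  assumes cont: "continuous_on {a..b} f" and root: "\<And>x. x \<in> {a..b} \<Longrightarrow> f (f x) = F x"
  shows "forts a b f \<subseteq> forts a b F"
proof
  fix x assume x: "x \<in> forts a b f"
  then have xab: "x \<in> {a<..<b}" by (simp add: forts_def)
  show "x \<in> forts a b F"
  proof (rule ccontr)
    assume "x \<notin> forts a b F"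
    then obtain e where e: "0 < e" "{x - e..x + e} \<subseteq> {a..b}" "strictly_monotone_on {x - e..x + e} F"
      using not_fortD[OF xab] by blast
    have "inj_on f {x - e..x + e}"
    proof (rule inj_onI)
      fix y z assume yz: "y \<in> {x - e..x + e}" "z \<in> {x - e..x + e}" "f y = f z"
      then have "F y = F z" using root[of y] root[of z] e(2) by auto
      then show "y = z" using inj_onD[OF strictly_monotone_on_imp_inj_on[OF e(3)]] yz by blast
    qed
    then have "strictly_monotone_on {x - e..x + e} f"
      using strictly_monotone_on_iff_inj_on continuous_on_subset[OF cont e(2)] is_interval_cc by blast
    then show False using fort_not_monotone[OF x] e(1) by force
  qed
qed

text \<open>A strictly decreasing outer map reverses every comparison of values, so it only
  exchanges the two kinds of monotonicity. This keeps the fort count constant from the second to the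
  third iterate of the root.\<close>

lemma forts_comp_strict_antimono:
  assumes "strict_antimono_on K g" "F ` {a..b} \<subseteq> K"
  shows "forts a b (\<lambda>x. g (F x)) = forts a b F"
proof -
  have "strictly_monotone_on (U \<inter> {a..b}) (\<lambda>x. g (F x)) \<longleftrightarrow> strictly_monotone_on (U \<inter> {a..b}) F" for U
  proof -
    have "g (F x) < g (F y) \<longleftrightarrow> F y < F x" if "x \<in> {a..b}" "y \<in> {a..b}" for x y
      using strict_antimono_on_eq(1)[OF assms(1), of "F x" "F y"] assms(2) that by blast
    then show ?thesis unfolding strictly_monotone_on_def monotone_on_def by auto
  qed
  then show ?thesis unfolding forts_def by simp
qed

section \<open>Continuous lifts\<close>

lemma strict_mono_on_inverse:
  fixes f :: "real \<Rightarrow> real"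
  assumes "continuous_on {u..v} f" "strict_mono_on {u..v} f" "u \<le> v"
  obtains h where "continuous_on {f u..f v} h"
    "\<And>y. y \<in> {f u..f v} \<Longrightarrow> h y \<in> {u..v} \<and> f (h y) = y" "\<And>x. x \<in> {u..v} \<Longrightarrow> h (f x) = x"
proof -
  have im: "f ` {u..v} = {f u..f v}"
  proof (intro equalityI subsetI)
    show "y \<in> {f u..f v}" if "y \<in> f ` {u..v}" for y
      using that strict_mono_on_leD[OF assms(2)] assms(3) by auto
    show "y \<in> f ` {u..v}" if "y \<in> {f u..f v}" for y
      using that IVT'[of f u y v] assms by auto
  qed
  note inj = strict_mono_on_imp_inj_on[OF assms(2)]
  let ?h = "the_inv_into {u..v} f"
  have h: "?h (f x) = x" if "x \<in> {u..v}" for x using that by (rule the_inv_into_f_f[OF inj])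
  show thesis
  proof (rule that)
    show "continuous_on {f u..f v} ?h"
      using continuous_on_inv[OF assms(1), of ?h] h im by simp
    show "?h y \<in> {u..v} \<and> f (?h y) = y" if "y \<in> {f u..f v}" for y
      using that h unfolding im[symmetric] by auto
  qed (rule h)
qed

lemma continuous_on_glue:
  fixes f g :: "real \<Rightarrow> real"
  assumes "continuous_on {u..v} f" "continuous_on {v..w} g" "f v = g v"
  shows "continuous_on {u..w} (\<lambda>x. if x \<le> v then f x else g x)"
proof (rule continuous_on_cases_le)
  show "continuous_on {x \<in> {u..w}. x \<le> v} f" by (rule continuous_on_subset[OF assms(1)]) auto
  show "continuous_on {x \<in> {u..w}. v \<le> x} g" by (rule continuous_on_subset[OF assms(2)]) auto
qed (use assms(3) in \<open>auto intro: continuous_intros\<close>)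

lemma continuous_on_glue_chain:
  fixes d :: "nat \<Rightarrow> real" and h :: "nat \<Rightarrow> real \<Rightarrow> real"
  assumes "\<And>j. j \<le> t \<Longrightarrow> d j \<le> d (Suc j)"
    and "\<And>j. j \<le> t \<Longrightarrow> continuous_on {d j..d (Suc j)} (h j)"
    and "\<And>j. j < t \<Longrightarrow> h j (d (Suc j)) = h (Suc j) (d (Suc j))"
  shows "\<exists>f. continuous_on {d 0..d (Suc t)} f \<and> (\<forall>j \<le> t. \<forall>x \<in> {d j..d (Suc j)}. f x = h j x)"
  using assms
proof (induction t)
  case 0
  then show ?case by (intro exI[of _ "h 0"]) simp
next
  case (Suc t)
  then obtain f where f: "continuous_on {d 0..d (Suc t)} f"
    "\<And>j x. j \<le> t \<Longrightarrow> x \<in> {d j..d (Suc j)} \<Longrightarrow> f x = h j x"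
    by (metis le_SucI less_SucI)
  let ?f = "\<lambda>x. if x \<le> d (Suc t) then f x else h (Suc t) x"
  have ft: "f (d (Suc t)) = h (Suc t) (d (Suc t))"
    using f(2)[of t "d (Suc t)"] Suc.prems(1)[of t] Suc.prems(3)[of t] by simp
  have le: "d (Suc j) \<le> d (Suc t)" if "j \<le> t" for j
    using that
  proof (induction rule: inc_induct)
    case (step n)
    then show ?case using Suc.prems(1)[of "Suc n"] by simp
  qed simp
  have "continuous_on {d 0..d (Suc (Suc t))} ?f"
    using continuous_on_glue[OF f(1) Suc.prems(2)[of "Suc t"]] ft by simp
  moreover have "?f x = h j x" if "j \<le> Suc t" "x \<in> {d j..d (Suc j)}" for j x
  proof (cases "j = Suc t")
    case True
    then show ?thesis using that ft by (cases "x = d (Suc t)") auto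
  next
    case False
    then show ?thesis using that f(2)[of j x] le[of j] by simp
  qed
  ultimately show ?case by blast
qed

lemma chain_cover:
  fixes d :: "nat \<Rightarrow> real"
  assumes "x \<in> {d 0..d (Suc t)}"
  shows "\<exists>j \<le> t. x \<in> {d j..d (Suc j)}"
  using assms
proof (induction t)
  case (Suc t)
  show ?case
  proof (cases "x \<le> d (Suc t)")
    case True
    then show ?thesis using Suc by (auto intro: le_SucI)
  qed (use Suc.prems in \<open>auto intro!: exI[of _ "Suc t"]\<close>)
qed simp

text \<open>\<open>A\<close>, \<open>B\<close>, \<open>C\<close> are continuous right inverses of
  \<open>f0\<close>, used on successive segments in the cyclic order A, B, C, B; this is the period
  four of (L) and (R). The switches between \<open>A\<close> and \<open>B\<close> happen where
  \<open>\<Phi>\<close> equals \<open>e0\<close>, those between \<open>B\<close> and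
  \<open>C\<close> where it equals \<open>e1\<close>, and the right inverses agree at these values.
  The right end of the last segment is no switch and carries no value condition.\<close>

lemma zone_lift:
  fixes A B C f0 \<Phi> :: "real \<Rightarrow> real" and SA SB SC T :: "real set" and d :: "nat \<Rightarrow> real"
  defines "H \<equiv> \<lambda>j::nat. if j mod 4 = 0 then A else if j mod 4 = 2 then C else B"
    and "S \<equiv> \<lambda>j::nat. if j mod 4 = 0 then SA else if j mod 4 = 2 then SC else SB"
  assumes d: "\<And>j. j \<le> t \<Longrightarrow> d j \<le> d (Suc j)"
    and cont: "continuous_on {d 0..d (Suc t)} \<Phi>"
    and zone: "\<And>j x. j \<le> t \<Longrightarrow> x \<in> {d j..d (Suc j)} \<Longrightarrow> \<Phi> x \<in> S j"
    and node: "\<And>j. j \<le> t \<Longrightarrow> \<Phi> (d j) = (if j mod 4 \<in> {0, 1} then e0 else e1)"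
    and conts: "continuous_on SA A" "continuous_on SB B" "continuous_on SC C"
    and ends: "A e0 = B e0" "B e1 = C e1"
    and sections: "\<And>y. y \<in> SA \<Longrightarrow> A y \<in> T \<and> f0 (A y) = y"
      "\<And>y. y \<in> SB \<Longrightarrow> B y \<in> T \<and> f0 (B y) = y" "\<And>y. y \<in> SC \<Longrightarrow> C y \<in> T \<and> f0 (C y) = y"
  obtains f where "continuous_on {d 0..d (Suc t)} f"
    "\<And>x. x \<in> {d 0..d (Suc t)} \<Longrightarrow> f x \<in> T \<and> f0 (f x) = \<Phi> x"
    "\<And>x. x \<in> {d 0..d 1} \<Longrightarrow> f x = A (\<Phi> x)"
proof -
  have mono: "d i \<le> d j" if "i \<le> j" "j \<le> Suc t" for i j
    using that
  proof (induction j rule: dec_induct)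
    case (step j)
    then show ?case using d[of j] by simp
  qed simp
  have "continuous_on {d j..d (Suc j)} (\<lambda>x. H j (\<Phi> x))" if j: "j \<le> t" for j
  proof (rule continuous_on_compose2[of "S j" "H j" _ \<Phi>])
    show "continuous_on (S j) (H j)" using conts by (simp add: H_def S_def)
    show "continuous_on {d j..d (Suc j)} \<Phi>"
      by (rule continuous_on_subset[OF cont]) (use mono[of 0 j] mono[of "Suc j" "Suc t"] j in auto)
    show "\<Phi> ` {d j..d (Suc j)} \<subseteq> S j" using zone j by blast
  qed
  moreover have "H j (\<Phi> (d (Suc j))) = H (Suc j) (\<Phi> (d (Suc j)))" if "j < t" for j
  proof -
    consider "j mod 4 = 0" | "j mod 4 = 1" | "j mod 4 = 2" | "j mod 4 = 3" by linarith
    then show ?thesis using node[of "Suc j"] that ends by cases (auto simp: H_def mod_Suc)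
  qed
  ultimately obtain f where f: "continuous_on {d 0..d (Suc t)} f"
    "\<And>j x. j \<le> t \<Longrightarrow> x \<in> {d j..d (Suc j)} \<Longrightarrow> f x = H j (\<Phi> x)"
    using continuous_on_glue_chain[of t d "\<lambda>j x. H j (\<Phi> x)"] d by blast
  show thesis
  proof (rule that[OF f(1)])
    fix x assume "x \<in> {d 0..d (Suc t)}"
    then obtain j where j: "j \<le> t" "x \<in> {d j..d (Suc j)}" using chain_cover by blast
    show "f x \<in> T \<and> f0 (f x) = \<Phi> x"
      using f(2)[OF j] zone[OF j] sections[of "\<Phi> x"] by (auto simp: H_def S_def split: if_splits)
  next
    show "f x = A (\<Phi> x)" if "x \<in> {d 0..d 1}" for x using f(2)[of 0 x] that by (simp add: H_def)
  qed
qed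

section \<open>The square root of height two\<close>

theorem theorem2p4:
  fixes a b :: real and F :: "real \<Rightarrow> real" and c :: "nat \<Rightarrow> real" and v k :: nat
  assumes "a < b"
    and "pm_map a b F"
    and "forts a b F = c ` {1..v}"
    and "c 0 = a" and "c (v + 1) = b"
    and "strict_mono_on {0..v + 1} c"
    and "height a b F = 1"
    and "1 \<le> k" and "k \<le> v - 1"
    and "characteristic_interval a b F {c k..c (k + 1)}"
    and "strict_mono_on {c k..c (k + 1)} F"
    and "\<not> characteristic_endpoints_condition a b F (c k) (c (k + 1))"
    and "reversing_correspondence (c k) (c (k + 1)) F"
    and "(c k = F (c (k + 2)) \<and> F (c (k + 2)) < F (c k) \<and> F (c k) < F (c (k + 1)) \<and>
            F (c (k + 1)) = F (c (k - 1)) \<and> F (c (k - 1)) < c (k + 1)) \<or>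
         (c k < F (c (k + 2)) \<and> F (c (k + 2)) < F (c k) \<and> F (c k) < F (c (k + 1)) \<and>
            F (c (k + 1)) < F (c (k - 1)) \<and> F (c (k - 1)) < c (k + 1)) \<or>
         (c k < F (c (k + 2)) \<and> F (c (k + 2)) = F (c k) \<and> F (c k) < F (c (k + 1)) \<and>
            F (c (k + 1)) < F (c (k - 1)) \<and> F (c (k - 1)) = c (k + 1))"
    and L: "\<exists>(s :: nat) (l :: nat \<Rightarrow> nat).
        l 0 = k - 1 \<and> l (s + 1) = 0 \<and> (\<forall>j \<le> s + 1. l j \<le> v) \<and>
        (\<forall>j \<le> s. c (l j) > c (l (j + 1))) \<and>
        (\<forall>j \<le> s. (j mod 4 \<in> {0, 1} \<longrightarrow> F (c (l j)) = F (c (k - 1))) \<and>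
                 (j mod 4 \<in> {2, 3} \<longrightarrow> F (c (l j)) = F (c (k + 2)))) \<and>
        (\<forall>j \<le> s. j mod 4 \<in> {0, 1, 3} \<longrightarrow>
                 is_max_on {c (l (j + 1))..c (l j)} F (F (c (k - 1)))) \<and>
        (\<forall>j \<le> s. j mod 4 \<in> {1, 2, 3} \<longrightarrow>
                 is_min_on {c (l (j + 1))..c (l j)} F (F (c (k + 2))))"
    and R: "\<exists>(t :: nat) (r :: nat \<Rightarrow> nat).
        r 0 = k + 2 \<and> r (t + 1) = v + 1 \<and> (\<forall>j \<le> t + 1. r j \<in> {1..v + 1}) \<and>
        (\<forall>j \<le> t. c (r j) < c (r (j + 1))) \<and>
        (\<forall>j \<le> t. (j mod 4 \<in> {0, 1} \<longrightarrow> F (c (r j)) = F (c (k + 2))) \<and>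
                 (j mod 4 \<in> {2, 3} \<longrightarrow> F (c (r j)) = F (c (k - 1)))) \<and>
        (\<forall>j \<le> t. j mod 4 \<in> {0, 1, 3} \<longrightarrow>
                 is_min_on {c (r j)..c (r (j + 1))} F (F (c (k + 2)))) \<and>
        (\<forall>j \<le> t. j mod 4 \<in> {1, 2, 3} \<longrightarrow>
                 is_max_on {c (r j)..c (r (j + 1))} F (F (c (k - 1))))"
  shows "\<exists>f. continuous_on {a..b} f \<and> f ` {a..b} \<subseteq> {a..b} \<and>
             (\<forall>x \<in> {a..b}. f (f x) = F x) \<and>
             pm_map a b f \<and> height a b f = 2 \<and>
             strict_antimono_on {c k..c (k + 1)} f"
proof -
  define e p q w where "e = c (k - 1)" and "p = c k" and "q = c (k + 1)" and "w = c (k + 2)"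
  define m M where "m = F w" and "M = F e"
  note defs = e_def p_def q_def w_def
  obtain s :: nat and l :: "nat \<Rightarrow> nat" where l: "l 0 = k - 1" "l (s + 1) = 0" "\<And>j. j \<le> s + 1 \<Longrightarrow> l j \<le> v"
      "\<And>j. j \<le> s \<Longrightarrow> c (l j) > c (l (j + 1))"
    and l_node: "\<And>j. j \<le> s \<Longrightarrow> (j mod 4 \<in> {0, 1} \<longrightarrow> F (c (l j)) = M) \<and>
      (j mod 4 \<in> {2, 3} \<longrightarrow> F (c (l j)) = m)"
    and l_max: "\<And>j. j \<le> s \<Longrightarrow> j mod 4 \<in> {0, 1, 3} \<Longrightarrow> is_max_on {c (l (j + 1))..c (l j)} F M"
    and l_min: "\<And>j. j \<le> s \<Longrightarrow> j mod 4 \<in> {1, 2, 3} \<Longrightarrow> is_min_on {c (l (j + 1))..c (l j)} F m"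
    using L unfolding M_def m_def e_def w_def by blast
  obtain t :: nat and r :: "nat \<Rightarrow> nat" where r: "r 0 = k + 2" "r (t + 1) = v + 1" "\<And>j. j \<le> t + 1 \<Longrightarrow> r j \<in> {1..v + 1}"
      "\<And>j. j \<le> t \<Longrightarrow> c (r j) < c (r (j + 1))"
    and r_node: "\<And>j. j \<le> t \<Longrightarrow> (j mod 4 \<in> {0, 1} \<longrightarrow> F (c (r j)) = m) \<and>
      (j mod 4 \<in> {2, 3} \<longrightarrow> F (c (r j)) = M)"
    and r_min: "\<And>j. j \<le> t \<Longrightarrow> j mod 4 \<in> {0, 1, 3} \<Longrightarrow> is_min_on {c (r j)..c (r (j + 1))} F m"
    and r_max: "\<And>j. j \<le> t \<Longrightarrow> j mod 4 \<in> {1, 2, 3} \<Longrightarrow> is_max_on {c (r j)..c (r (j + 1))} F M"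
    using R unfolding M_def m_def e_def w_def by blast
  have c_less: "c i < c j" if "i < j" "j \<le> v + 1" for i j
    using strict_mono_onD[OF \<open>strict_mono_on {0..v + 1} c\<close>] that by simp
  have c_le: "c i \<le> c j" if "i \<le> j" "j \<le> v + 1" for i j
    using c_less[of i j] that by (cases "i = j") auto
  \<comment> \<open>Each chain has at least one link of positive length. Hence \<open>w\<close> is
    not \<open>b\<close>, so it is a fort with a further lap to its right, and \<open>e\<close> is
    not \<open>a\<close>.\<close>
  have r1: "k + 2 < r 1" "r 1 \<le> v + 1"
  proof -
    show le: "r 1 \<le> v + 1" using r(3)[of 1] by simp
    have "c (k + 2) < c (r 1)" using r(1) r(4)[of 0] by simp
    then show "k + 2 < r 1"
      using c_le[of "r 1" "k + 2"] \<open>1 \<le> k\<close> \<open>k \<le> v - 1\<close> by linarith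
  qed
  have l1: "l 1 < k - 1"
  proof -
    have "c (l 1) < c (k - 1)" "l 1 \<le> v" using l(1) l(3)[of 1] l(4)[of 0] by simp_all
    then show ?thesis using c_le[of "k - 1" "l 1"] by linarith
  qed
  have abc: "a < e" "e < p" "p < q" "q < w" "w < c (k + 3)" "c (k + 3) \<le> b"
    using c_less[of 0 "k - 1"] c_less[of "k - 1" k] c_less[of k "k + 1"] c_less[of "k + 1" "k + 2"]
      c_less[of "k + 2" "k + 3"] c_le[of "k + 3" "v + 1"] l1 r1 \<open>c 0 = a\<close> \<open>c (v + 1) = b\<close>
    unfolding defs by auto
  have cont: "continuous_on {a..b} F" and fin: "finite (forts a b F)"
    using \<open>pm_map a b F\<close> by (auto simp: pm_map_def)
  have contF: "continuous_on {x..y} F" if "a \<le> x" "y \<le> b" for x y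
    by (rule continuous_on_subset[OF cont]) (use that in auto)
  have range: "p \<le> F x \<and> F x \<le> q" if "a \<le> x" "x \<le> b" for x
    using \<open>characteristic_interval a b F {c k..c (k + 1)}\<close> that
    unfolding characteristic_interval_def defs by force
  have cases: "p = m \<and> m < F p \<and> F p < F q \<and> F q = M \<and> M < q \<or>
      p < m \<and> m < F p \<and> F p < F q \<and> F q < M \<and> M < q \<or>
      p < m \<and> m = F p \<and> F p < F q \<and> F q < M \<and> M = q"
    using assms(14) unfolding m_def M_def defs by simp
  then have ord: "p \<le> m" "m \<le> F p" "p < F p" "F p < F q" "F q < q" "F q \<le> M" "M \<le> q"
    by auto

  \<comment> \<open>Monotonicity of F on the laps next to the characteristic interval\<close>
  have lap: "strictly_monotone_on {c i..c (i + 1)} F" if "i \<le> v" for i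
  proof (rule fort_free_imp_strictly_monotone[of _ _ _ a b])
    have "a \<le> c i" "c (i + 1) \<le> b"
      using that c_le[of 0 i] c_le[of "i + 1" "v + 1"] \<open>c 0 = a\<close> \<open>c (v + 1) = b\<close> by auto
    then show "{c i..c (i + 1)} \<subseteq> {a..b}" "continuous_on {c i..c (i + 1)} F" using contF by auto
    have no: False if "j \<in> {1..v}" "c i < c j" "c j < c (i + 1)" for j
      using that \<open>i \<le> v\<close> c_le[of j i] c_le[of "i + 1" j] by (cases "j \<le> i") auto
    show "{c i<..<c (i + 1)} \<inter> forts a b F = {}"
    proof (rule equals0I)
      fix z assume "z \<in> {c i<..<c (i + 1)} \<inter> forts a b F"
      then obtain j where "j \<in> {1..v}" "z = c j" "c i < z" "z < c (i + 1)"
        using \<open>forts a b F = c ` {1..v}\<close> by auto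
      then show False using no by blast
    qed
  qed
  have inc: "strict_mono_on {p..q} F" using assms(11) unfolding defs .
  \<comment> \<open>The end values decide the direction: \<open>F e = M > F p\<close> here, and
    \<open>F w = m < F q\<close> on the other side.\<close>
  have dec1: "strict_antimono_on {e..p} F"
  proof -
    have "strictly_monotone_on {e..p} F" using lap[of "k - 1"] l1 r1 unfolding defs by simp
    moreover have "\<not> strict_mono_on {e..p} F"
      using strict_mono_onD[of "{e..p}" F e p] abc ord M_def by force
    ultimately show ?thesis unfolding strictly_monotone_on_def by blast
  qed
  have dec2: "strict_antimono_on {q..w} F"
  proof -
    have "strictly_monotone_on {q..w} F" using lap[of "k + 1"] r1 unfolding defs by simp
    moreover have "\<not> strict_mono_on {q..w} F"
      using strict_mono_onD[of "{q..w}" F q w] abc ord m_def by force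
    ultimately show ?thesis unfolding strictly_monotone_on_def by blast
  qed
  \<comment> \<open>These bounds make \<open>gi (F x)\<close> a point of [p, q], where
    \<open>f0\<close> is \<open>g\<close>; so \<open>f0\<close> is its own lift of \<open>F\<close>
    on [e, w].\<close>
  have middle: "m \<le> F x \<and> F x \<le> M" if "e \<le> x" "x \<le> w" for x
  proof -
    consider "x \<le> p" | "p \<le> x" "x \<le> q" | "q \<le> x" by linarith
    then show ?thesis
    proof cases
      case 1
      then have "F p \<le> F x" "F x \<le> F e"
        using strict_antimono_on_eq(1)[OF dec1, of x p] strict_antimono_on_eq(1)[OF dec1, of e x] that abc
        by (auto simp: not_less[symmetric])
      then show ?thesis using ord M_def by simp
    next
      case 2
      then have "F p \<le> F x" "F x \<le> F q" using strict_mono_on_leD[OF inc] abc by auto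
      then show ?thesis using ord by simp
    next
      case 3
      then have "F x \<le> F q" "F w \<le> F x"
        using strict_antimono_on_eq(1)[OF dec2, of x w] strict_antimono_on_eq(1)[OF dec2, of q x] that abc
        by (auto simp: not_less[symmetric])
      then show ?thesis using ord m_def by simp
    qed
  qed

  \<comment> \<open>The root on the characteristic interval and the three inverse branches\<close>
  have rc: "reversing_correspondence p q F" using assms(13) unfolding defs .
  have mM: "m = p \<and> M = F q \<or> m = F p \<and> M = q \<or> p < m \<and> m < F p \<and> F q < M \<and> M < q"
    using cases by auto
  obtain g where g: "strict_antimono_on UNIV g" "surj g" "\<And>x. x \<in> {p..q} \<Longrightarrow> g (g x) = F x"
    "g p = M" "g q = m"
    using reversing_correspondence_root[OF rc abc(3) ord(3,5) mM] by blast
  have g_less: "g x < g y \<longleftrightarrow> y < x" and g_eq: "g x = g y \<longleftrightarrow> x = y" for x y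
    using strict_antimono_on_eq[OF g(1)] by auto
  define gi where "gi = inv g"
  have g_gi: "g (gi x) = x" for x using g(2) by (simp add: gi_def surj_f_inv_f)
  have gi_g: "gi (g x) = x" for x using g_gi g_eq by blast
  have gi_less: "gi x < gi y \<longleftrightarrow> y < x" for x y using g_less[of "gi y" "gi x"] g_gi by simp
  have gi_le: "gi x \<le> gi y \<longleftrightarrow> y \<le> x" for x y using gi_less[of y x] by (simp add: not_less[symmetric])
  have gi_vals: "gi M = p" "gi m = q" "gi (F p) = M" "gi (F q) = m"
    using gi_g[of p] gi_g[of q] gi_g[of "g p"] gi_g[of "g q"] g(3)[of p] g(3)[of q] g(4,5) abc(3)
    by simp_all
  \<comment> \<open>A monotone map onto the whole line is continuous; the negation is taken to make
    \<open>gi\<close> increasing.\<close>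
  have cont_gi: "continuous_on A gi" for A
  proof -
    have "surj gi" using gi_g by (rule surjI)
    then have "range (\<lambda>x. - gi x) = UNIV" by (metis surj_def surj_uminus minus_minus UNIV_I surjI)
    then have "continuous_on UNIV (\<lambda>x. - gi x)"
      by (intro continuous_onI_mono) (auto simp: gi_le)
    then have "continuous_on UNIV gi" using continuous_on_minus by fastforce
    then show ?thesis by (rule continuous_on_subset) simp
  qed
  define f0 where "f0 x = gi (F x)" for x
  have cont_f0: "continuous_on {x..y} f0" if "a \<le> x" "y \<le> b" for x y
    unfolding f0_def using continuous_on_compose2[OF cont_gi[of UNIV] contF[OF that]] by simp
  have f0_K: "f0 x = g x" if "p \<le> x" "x \<le> q" for x
    using g(3)[of x] that gi_g[of "g x"] by (simp add: f0_def)
  have f0_vals: "f0 e = p" "f0 p = M" "f0 q = m" "f0 w = q"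
    using gi_vals by (simp_all add: f0_def M_def m_def)
  have f0_inc1: "strict_mono_on {e..p} f0" and f0_inc2: "strict_mono_on {q..w} f0"
    using dec1 dec2 unfolding monotone_on_def f0_def gi_less by blast+
  have f0_gi: "f0 (gi y) = y" and gi_K: "p \<le> gi y" "gi y \<le> q" if "m \<le> y" "y \<le> M" for y
  proof -
    show "p \<le> gi y" "gi y \<le> q" using gi_le[of M y] gi_le[of y m] gi_vals that by auto
    then show "f0 (gi y) = y" using f0_K g_gi by simp
  qed
  obtain h1 where h1: "continuous_on {p..M} h1" "\<And>y. y \<in> {p..M} \<Longrightarrow> h1 y \<in> {e..p} \<and> f0 (h1 y) = y"
      "\<And>x. x \<in> {e..p} \<Longrightarrow> h1 (f0 x) = x"
    using strict_mono_on_inverse[OF cont_f0 f0_inc1, unfolded f0_vals] abc by auto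
  obtain h2 where h2: "continuous_on {m..q} h2" "\<And>y. y \<in> {m..q} \<Longrightarrow> h2 y \<in> {q..w} \<and> f0 (h2 y) = y"
      "\<And>x. x \<in> {q..w} \<Longrightarrow> h2 (f0 x) = x"
    using strict_mono_on_inverse[OF cont_f0 f0_inc2, unfolded f0_vals] abc by auto
  have h_vals: "h1 p = e" "h1 M = p" "h2 m = q" "h2 q = w"
    using h1(3)[of e] h1(3)[of p] h2(3)[of q] h2(3)[of w] f0_vals abc by auto
  have sections: "\<And>y. y \<in> {p..M} \<Longrightarrow> h1 y \<in> {e..w} \<and> f0 (h1 y) = y"
    "\<And>y. y \<in> {m..q} \<Longrightarrow> h2 y \<in> {e..w} \<and> f0 (h2 y) = y"
    "\<And>y. y \<in> {m..M} \<Longrightarrow> gi y \<in> {e..w} \<and> f0 (gi y) = y"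
    using h1(2) h2(2) f0_gi gi_K abc by force+
  have mod4: "j mod 4 \<in> {0, 1, 2, 3}" for j :: nat
    using mod_less_divisor[of 4 j] by (simp only: insert_iff) linarith

  \<comment> \<open>Lifting F through \<open>f0\<close> on both sides of [e, w]\<close>
  obtain fR where fR: "continuous_on {w..b} fR" "\<And>x. x \<in> {w..b} \<Longrightarrow> fR x \<in> {e..w} \<and> f0 (fR x) = F x"
    "\<And>x. x \<in> {w..c (r 1)} \<Longrightarrow> fR x = h2 (F x)"
  proof (rule zone_lift[where d="\<lambda>j. c (r j)" and t=t and \<Phi>=F and A=h2 and B=gi and C=h1
        and SA="{m..q}" and SB="{m..M}" and SC="{p..M}" and ?e0.0=m and ?e1.0=M and T="{e..w}" and ?f0.0=f0])
    have ends: "c (r 0) = w" "c (r (Suc t)) = b" using r(1,2) \<open>c (v + 1) = b\<close> by (auto simp: w_def)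
    have r_in: "a \<le> c (r j)" "c (r j) \<le> b" if "j \<le> Suc t" for j
      using c_le[of 0 "r j"] c_le[of "r j" "v + 1"] r(3)[of j] that \<open>c 0 = a\<close> \<open>c (v + 1) = b\<close> by auto
    show "continuous_on {c (r 0)..c (r (Suc t))} F" using contF r_in by simp
    show "c (r j) \<le> c (r (Suc j))" if "j \<le> t" for j using r(4)[OF that] by simp
    \<comment> \<open>Since \<open>range\<close> bounds \<open>F\<close> by \<open>p\<close> and
      \<open>q\<close> everywhere, \<open>h2\<close> requires only the lower bound \<open>m\<close>
      and \<open>h1\<close> only the upper bound \<open>M\<close>, while \<open>gi\<close> requires
      both. This explains which extrema (L) and (R) prescribe for each residue.\<close>
    show "F x \<in> (if j mod 4 = 0 then {m..q} else if j mod 4 = 2 then {p..M} else {m..M})"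
      if j: "j \<le> t" "x \<in> {c (r j)..c (r (Suc j))}" for j x
    proof -
      have "p \<le> F x" "F x \<le> q" using range[of x] r_in[of j] r_in[of "Suc j"] j by auto
      moreover have "m \<le> F x" if "j mod 4 \<in> {0, 1, 3}"
        using r_min[OF j(1) that] j(2) by (simp add: is_min_on_def)
      moreover have "F x \<le> M" if "j mod 4 \<in> {1, 2, 3}"
        using r_max[OF j(1) that] j(2) by (simp add: is_max_on_def)
      ultimately show ?thesis using mod4[of j] by auto
    qed
    show "F (c (r j)) = (if j mod 4 \<in> {0, 1} then m else M)" if "j \<le> t" for j
      using r_node[OF that] mod4[of j] by auto
    show "h2 m = gi m" "gi M = h1 M" using h_vals gi_vals by auto
    show thesis if "continuous_on {c (r 0)..c (r (Suc t))} fR"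
      "\<And>x. x \<in> {c (r 0)..c (r (Suc t))} \<Longrightarrow> fR x \<in> {e..w} \<and> f0 (fR x) = F x"
      "\<And>x. x \<in> {c (r 0)..c (r 1)} \<Longrightarrow> fR x = h2 (F x)" for fR
      using that \<open>\<And>fR. \<lbrakk>continuous_on {w..b} fR; \<And>x. x \<in> {w..b} \<Longrightarrow> fR x \<in> {e..w} \<and> f0 (fR x) = F x;
        \<And>x. x \<in> {w..c (r 1)} \<Longrightarrow> fR x = h2 (F x)\<rbrakk> \<Longrightarrow> thesis\<close> unfolding ends by blast
  qed (use h1(1) h2(1) cont_gi sections in auto)
  \<comment> \<open>Reflection turns the chain running leftwards into an increasing one. The left
    chain starts at \<open>e\<close> with value \<open>M\<close>, so \<open>h1\<close> and
    \<open>h2\<close> exchange roles, as do \<open>M\<close> and \<open>m\<close>.\<close>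
  obtain fL where fL: "continuous_on {- e..- a} fL"
    "\<And>x. x \<in> {- e..- a} \<Longrightarrow> fL x \<in> {e..w} \<and> f0 (fL x) = F (- x)" "fL (- e) = p"
  proof (rule zone_lift[where d="\<lambda>j. - c (l j)" and t=s and \<Phi>="\<lambda>x. F (- x)" and A=h1 and B=gi and C=h2
        and SA="{p..M}" and SB="{m..M}" and SC="{m..q}" and ?e0.0=M and ?e1.0=m and T="{e..w}" and ?f0.0=f0])
    have ends: "- c (l 0) = - e" "- c (l (Suc s)) = - a" using l(1,2) \<open>c 0 = a\<close> by (auto simp: e_def)
    have l_in: "a \<le> c (l j)" "c (l j) \<le> b" if "j \<le> Suc s" for j
      using c_le[of 0 "l j"] c_le[of "l j" "v + 1"] l(3)[of j] that \<open>c 0 = a\<close> \<open>c (v + 1) = b\<close> by auto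
    show "continuous_on {- c (l 0)..- c (l (Suc s))} (\<lambda>x. F (- x))"
      by (rule continuous_on_compose2[OF cont]) (use l_in[of 0] l_in[of "Suc s"] in \<open>auto intro!: continuous_intros\<close>)
    show "- c (l j) \<le> - c (l (Suc j))" if "j \<le> s" for j using l(4)[OF that] by simp
    show "F (- x) \<in> (if j mod 4 = 0 then {p..M} else if j mod 4 = 2 then {m..q} else {m..M})"
      if j: "j \<le> s" "x \<in> {- c (l j)..- c (l (Suc j))}" for j x
    proof -
      have x: "- x \<in> {c (l (j + 1))..c (l j)}" using j(2) by auto
      then have "p \<le> F (- x)" "F (- x) \<le> q" using range[of "- x"] l_in[of j] l_in[of "Suc j"] j by auto
      moreover have "m \<le> F (- x)" if "j mod 4 \<in> {1, 2, 3}"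
        using l_min[OF j(1) that] x by (simp add: is_min_on_def)
      moreover have "F (- x) \<le> M" if "j mod 4 \<in> {0, 1, 3}"
        using l_max[OF j(1) that] x by (simp add: is_max_on_def)
      ultimately show ?thesis using mod4[of j] by auto
    qed
    show "F (- (- c (l j))) = (if j mod 4 \<in> {0, 1} then M else m)" if "j \<le> s" for j
      using l_node[OF that] mod4[of j] by auto
    show "h1 M = gi M" "gi m = h2 m" using h_vals gi_vals by auto
    show thesis if f: "continuous_on {- c (l 0)..- c (l (Suc s))} fL"
      "\<And>x. x \<in> {- c (l 0)..- c (l (Suc s))} \<Longrightarrow> fL x \<in> {e..w} \<and> f0 (fL x) = F (- x)"
      "\<And>x. x \<in> {- c (l 0)..- c (l 1)} \<Longrightarrow> fL x = h1 (F (- x))" for fL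
    proof -
      have "fL (- e) = p" using f(3)[of "- e"] l(4)[of 0] h_vals ends by (simp add: M_def)
      then show thesis using f(1,2) \<open>\<And>fL. \<lbrakk>continuous_on {- e..- a} fL;
        \<And>x. x \<in> {- e..- a} \<Longrightarrow> fL x \<in> {e..w} \<and> f0 (fL x) = F (- x); fL (- e) = p\<rbrakk> \<Longrightarrow> thesis\<close>
        unfolding ends by blast
    qed
  qed (use h1(1) h2(1) cont_gi sections in auto)

  \<comment> \<open>Gluing the pieces to a root of F\<close>
  define f where "f x = (if x \<le> e then fL (- x) else if x \<le> w then f0 x else fR x)" for x
  have f_mid: "f x = f0 x" if "e \<le> x" "x \<le> w" for x
    using that fL(3) f0_vals by (cases "x = e") (auto simp: f_def)
  have fRw: "fR w = q"
    using fR(3)[of w] r(1) r(4)[of 0] h_vals by (simp add: m_def w_def)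
  have f_right: "f x = fR x" if "w \<le> x" for x
    using that fRw f0_vals abc by (cases "x = w") (auto simp: f_def)
  have contf: "continuous_on {a..b} f"
    unfolding f_def
  proof (rule continuous_on_glue)
    show "continuous_on {a..e} (\<lambda>x. fL (- x))"
      by (rule continuous_on_compose2[OF fL(1)]) (auto intro!: continuous_intros)
    show "continuous_on {e..b} (\<lambda>x. if x \<le> w then f0 x else fR x)"
      by (rule continuous_on_glue) (use cont_f0 fR(1) fRw f0_vals abc in auto)
    show "fL (- e) = (if e \<le> w then f0 e else fR e)" using fL(3) f0_vals abc by simp
  qed
  have lift: "f x \<in> {e..w} \<and> f0 (f x) = F x" if x: "x \<in> {a..b}" for x
  proof -
    consider "x \<le> e" | "e \<le> x" "x \<le> w" | "w \<le> x" by linarith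
    then show ?thesis
    proof cases
      case 1
      then show ?thesis using fL(2)[of "- x"] x by (simp add: f_def)
    next
      case 2
      then show ?thesis using sections(3)[of "F x"] middle[OF 2] f_mid[OF 2] by (simp add: f0_def)
    next
      case 3
      then show ?thesis using fR(2)[of x] x f_right[OF 3] by simp
    qed
  qed
  have self: "f ` {a..b} \<subseteq> {a..b}" using lift abc by force
  \<comment> \<open>All values of \<open>f\<close> lie in [e, w], where \<open>f\<close> is
    \<open>f0\<close>, so being a lift through \<open>f0\<close> is the same as being a square
    root.\<close>
  have root: "f (f x) = F x" if "x \<in> {a..b}" for x
    using lift[OF that] f_mid by auto
  have anti: "strict_antimono_on {p..q} f"
    using g(1) f_mid f0_K abc unfolding monotone_on_def by auto

  \<comment> \<open>Forts of the iterates and the height\<close>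
  have sub: "forts a b f \<subseteq> forts a b F"
    by (rule forts_subset_of_iterative_root[OF contf root])
  have pm: "pm_map a b f" using contf self finite_subset[OF sub fin] by (simp add: pm_map_def)
  have p_fort: "p \<in> forts a b f"
  proof (rule turning_point_fort[OF _ anti])
    show "strict_mono_on {e..p} f" using f0_inc1 f_mid abc unfolding monotone_on_def by auto
  qed (use abc in auto)
  \<comment> \<open>On the lap to the right of \<open>w\<close>, which ends no later than
    \<open>c (r 1)\<close>, \<open>f\<close> is \<open>h2\<close> after \<open>F\<close> and so
    stays at or above \<open>q = f w\<close>. It is injective there because \<open>F\<close> is,
    hence increasing, as it is on [q, w].\<close>
  have w_not_fort: "w \<notin> forts a b f"
  proof -
    let ?z = "c (k + 3)"
    have z: "?z \<le> c (r 1)" using c_le[of "k + 3" "r 1"] r1 by simp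
    have "inj_on F {w..?z}"
      using strictly_monotone_on_imp_inj_on lap[of "k + 2"] r1 by (simp add: w_def numeral_eq_Suc)
    then have "inj_on f {w..?z}"
      using root abc by (intro inj_onI) (smt (verit) atLeastAtMost_iff inj_on_def)
    moreover have ge: "q \<le> f x" if "x \<in> {w..?z}" for x
    proof -
      have "F x \<in> {m..q}"
        using r_min[of 0] range[of x] that z abc r(1) by (auto simp: is_min_on_def w_def)
      then show ?thesis using h2(2) fR(3)[of x] f_right[of x] that z by auto
    qed
    moreover have "continuous_on {w..?z} f"
      by (rule continuous_on_subset[OF contf]) (use abc in auto)
    ultimately have mono2: "strictly_monotone_on {w..?z} f"
      using strictly_monotone_on_iff_inj_on[OF is_interval_cc] by blast
    have fw: "f w = q" using f_right[of w] fRw by simp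
    have "\<not> strict_antimono_on {w..?z} f"
      using ge[of ?z] fw monotone_onD[of "{w..?z}" "(<)" "\<lambda>x y. y < x" f w ?z] abc by force
    then have mono2: "strict_mono_on {w..?z} f" using mono2 by (simp add: strictly_monotone_on_def)
    have mono1: "strict_mono_on {q..w} f" using f0_inc2 f_mid abc unfolding monotone_on_def by auto
    have "strict_mono_on {q..?z} f"
    proof (rule strict_mono_onI)
      fix x y assume xy: "x \<in> {q..?z}" "y \<in> {q..?z}" "x < y"
      consider "y \<le> w" | "x < w" "w < y" | "w \<le> x" by linarith
      then show "f x < f y"
      proof cases
        case 2
        then show ?thesis
          using strict_mono_onD[OF mono1, of x w] strict_mono_onD[OF mono2, of w y] xy by simp
      qed (use xy strict_mono_onD[OF mono1, of x y] strict_mono_onD[OF mono2, of x y] in auto)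
    qed
    then show ?thesis
      using fort_not_monotone[of w a b f q ?z] abc by (auto simp: strictly_monotone_on_def)
  qed
  have w_fort: "w \<in> forts a b F"
    using \<open>forts a b F = c ` {1..v}\<close> r1 by (auto simp: w_def)
  have "forts a b (f ^^ 0) = {}" using forts_id by (simp add: id_def)
  then have N0: "fort_count a b (f ^^ 0) = 0" by (simp add: fort_count_def)
  have N1: "fort_count a b (f ^^ 1) = card (forts a b f)" by (simp add: fort_count_def)
  have "forts a b (f ^^ 2) = forts a b F"
    by (rule forts_cong) (simp add: numeral_2_eq_2 root)
  then have N2: "fort_count a b (f ^^ 2) = card (forts a b F)" by (simp add: fort_count_def)
  \<comment> \<open>The third iterate is \<open>f\<close> after \<open>F\<close>, and
    \<open>f\<close> is strictly decreasing on [p, q], which contains the range of \<open>F\<close>.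
    No fort is gained after the second iterate.\<close>
  have "forts a b (f ^^ 3) = forts a b (\<lambda>x. f (F x))"
    by (rule forts_cong) (simp add: numeral_3_eq_3 root)
  also have "\<dots> = forts a b F"
    by (rule forts_comp_strict_antimono[OF anti]) (use range in auto)
  finally have N3: "fort_count a b (f ^^ Suc 2) = card (forts a b F)" by (simp add: fort_count_def)
  have card_pos: "0 < card (forts a b f)" using p_fort finite_subset[OF sub fin] by (auto simp: card_gt_0_iff)
  have card_less: "card (forts a b f) < card (forts a b F)"
    by (rule psubset_card_mono[OF fin]) (use sub w_fort w_not_fort in auto)
  have ne: "fort_count a b (f ^^ i) \<noteq> fort_count a b (f ^^ Suc i)" if i: "i < 2" for i
  proof -
    consider "i = 0" | "i = 1" using i by linarith
    then show ?thesis
    proof cases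
      case 1
      then show ?thesis using N0 N1 card_pos by simp
    next
      case 2
      then have "Suc i = 2" by simp
      then have "fort_count a b (f ^^ Suc i) = card (forts a b F)" using N2 by (simp only:)
      then show ?thesis using N1 card_less unfolding 2 by linarith
    qed
  qed
  have "(LEAST i. fort_count a b (f ^^ i) = fort_count a b (f ^^ Suc i)) = 2"
    by (rule Least_equality) (use N2 N3 ne in \<open>auto simp: not_less[symmetric]\<close>)
  moreover have "\<exists>i. fort_count a b (f ^^ i) = fort_count a b (f ^^ Suc i)" using N2 N3 by metis
  ultimately have "height a b f = 2" unfolding height_def by (simp add: numeral_eq_enat)
  moreover have "strict_antimono_on {c k..c (k + 1)} f" using anti unfolding defs .
  ultimately show ?thesis using contf self root pm by blast
qed

end
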